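(* Let $k$ be a field and $M$ a finite monoid which is an inverse semigroup and satisfies the $k$-C.A. condition. Then $k[M]$ is semisimple if and only if $k[G_D]$ is semisimple for every $\mathcal{D}$-class $D$ of $M$.
   Context: An inverse semigroup is a semigroup in which every element $a$ has a unique inverse $a^{-1}$, i.e. a unique element with $aa^{-1}a=a$ and $a^{-1}aa^{-1}=a^{-1}$. Green's relations: $x\mathcal{L}y$ iff $Mx=My$; $x\mathcal{R}y$ iff $xM=yM$; $\mathcal{H}=\mathcal{L}\cap\mathcal{R}$; $\mathcal{D}=\mathcal{L}\circ\mathcal{R}$. Schutzenberger group of a $\mathcal{D}$-class $D$: pick an $\mathcal{H}$-class $H\subseteq D$, put $RT(H)=\{m\in M:Hm\subseteq H\}$, $r_m:H\to H$, $h\mapsto hm$, and $G_D=\{r_m:m\in RT(H)\}$ with product $r_mr_n=r_{mn}$; up to isomorphism this depends only on $D$. The $k$-C.A. condition: for every $\mathcal{D}$-class $D$ of $M$, the group algebra $k[G_D]$ has a cell algebra structure. Here a cell algebra over $k$ is an associative unital $k$-algebra $A$ with a finite poset $\Lambda$, finite sets $L(\lambda),R(\lambda)$ for $\lambda\in\Lambda$, and a $k$-basis $C=\{{}_sC_t^\lambda:\lambda\in\Lambda,s\in L(\lambda),t\in R(\lambda)\}$ (indexed injectively) such that, with $\hat A^\lambda=\text{span}\{{}_sC_t^\mu:\mu>\lambda\}$: (i) for all $a\in A,\lambda,s,s'$ there is $r_L(a,\lambda,s,s')\in k$ with $a\,{}_sC_t^\lambda\equiv\sum_{s'\in L(\lambda)}r_L(a,\lambda,s,s')\,{}_{s'}C_t^\lambda\bmod\hat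 A^\lambda$ for every $t\in R(\lambda)$; (ii) for all $a,\lambda,t,t'$ there is $r_R(a,\lambda,t,t')\in k$ with ${}_sC_t^\lambda\,a\equiv\sum_{t'\in R(\lambda)}r_R(a,\lambda,t,t')\,{}_sC_{t'}^\lambda\bmod\hat A^\lambda$ for every $s\in L(\lambda)$. *)

theory Defs
  imports "HOL-Algebra.AbelCoset" "HOL-Algebra.Module"
begin

definition inverse_semigroup :: "('m, 's) monoid_scheme \<Rightarrow> bool" where
  "inverse_semigroup M \<longleftrightarrow>
     (\<forall>a\<in>carrier M. \<forall>b\<in>carrier M. a \<otimes>\<^bsub>M\<^esub> b \<in> carrier M) \<and>
     (\<forall>a\<in>carrier M. \<forall>b\<in>carrier M. \<forall>c\<in>carrier M.
        (a \<otimes>\<^bsub>M\<^esub> b) \<otimes>\<^bsub>M\<^esub> c = a \<otimes>\<^bsub>M\<^esub> (b \<otimes>\<^bsub>M\<^esub> c)) \<and>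
     (\<forall>a\<in>carrier M. \<exists>!b. b \<in> carrier M \<and>
        a \<otimes>\<^bsub>M\<^esub> b \<otimes>\<^bsub>M\<^esub> a = a \<and> b \<otimes>\<^bsub>M\<^esub> a \<otimes>\<^bsub>M\<^esub> b = b)"

definition green_L :: "('m, 's) monoid_scheme \<Rightarrow> 'm rel" where
  "green_L M = {(x, y) \<in> carrier M \<times> carrier M. carrier M #>\<^bsub>M\<^esub> x = carrier M #>\<^bsub>M\<^esub> y}"

definition green_R :: "('m, 's) monoid_scheme \<Rightarrow> 'm rel" where
  "green_R M = {(x, y) \<in> carrier M \<times> carrier M. x <#\<^bsub>M\<^esub> carrier M = y <#\<^bsub>M\<^esub> carrier M}"

definition green_H :: "('m, 's) monoid_scheme \<Rightarrow> 'm rel" where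
  "green_H M = green_L M \<inter> green_R M"

definition green_D :: "('m, 's) monoid_scheme \<Rightarrow> 'm rel" where
  "green_D M = green_L M O green_R M"

definition H_classes :: "('m, 's) monoid_scheme \<Rightarrow> 'm set set" where
  "H_classes M = carrier M // green_H M"

definition D_classes :: "('m, 's) monoid_scheme \<Rightarrow> 'm set set" where
  "D_classes M = carrier M // green_D M"

definition RT :: "('m, 's) monoid_scheme \<Rightarrow> 'm set \<Rightarrow> 'm set" where
  "RT M H = {m \<in> carrier M. H #>\<^bsub>M\<^esub> m \<subseteq> H}"

definition right_transl :: "('m, 's) monoid_scheme \<Rightarrow> 'm set \<Rightarrow> 'm \<Rightarrow> ('m \<Rightarrow> 'm)" where
  "right_transl M H m = (\<lambda>h\<in>H. h \<otimes>\<^bsub>M\<^esub> m)"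

text \<open>The product of \<open>r\<^sub>m\<close> and \<open>r\<^sub>n\<close> has to be \<open>r\<^sub>m\<^sub>n\<close>, so the left factor acts first.\<close>

definition schutzenberger_of :: "('m, 's) monoid_scheme \<Rightarrow> 'm set \<Rightarrow> ('m \<Rightarrow> 'm) monoid" where
  "schutzenberger_of M H =
     \<lparr>carrier = right_transl M H ` RT M H,
      mult = (\<lambda>f g. compose H g f),
      one = (\<lambda>h\<in>H. h)\<rparr>"

text \<open>The group \<open>G\<^sub>D\<close>, formed at an arbitrarily picked H-class inside \<open>D\<close>.\<close>

definition schutzenberger_group :: "('m, 's) monoid_scheme \<Rightarrow> 'm set \<Rightarrow> ('m \<Rightarrow> 'm) monoid" where
  "schutzenberger_group M D = schutzenberger_of M (SOME H. H \<in> H_classes M \<and> H \<subseteq> D)"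

text \<open>The locale \<open>algebra\<close> of HOL-Algebra only covers commutative algebras.\<close>

locale assoc_algebra = module K A + ring A for K (structure) and A (structure) +
  assumes smult_mult_left:
      "\<lbrakk>c \<in> carrier K; x \<in> carrier A; y \<in> carrier A\<rbrakk> \<Longrightarrow>
       (c \<odot>\<^bsub>A\<^esub> x) \<otimes>\<^bsub>A\<^esub> y = c \<odot>\<^bsub>A\<^esub> (x \<otimes>\<^bsub>A\<^esub> y)"
    and smult_mult_right:
      "\<lbrakk>c \<in> carrier K; x \<in> carrier A; y \<in> carrier A\<rbrakk> \<Longrightarrow>
       x \<otimes>\<^bsub>A\<^esub> (c \<odot>\<^bsub>A\<^esub> y) = c \<odot>\<^bsub>A\<^esub> (x \<otimes>\<^bsub>A\<^esub> y)"

text \<open>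
  The monoid algebra of a \<^emph>\<open>finite\<close> monoid: an element is its coefficient function, the
  product is convolution.  For an infinite monoid one would have to add a finite support condition.
\<close>

definition monoid_algebra ::
    "('k, 'r) ring_scheme \<Rightarrow> ('m, 's) monoid_scheme \<Rightarrow> ('k, 'm \<Rightarrow> 'k) module" where
  "monoid_algebra K M =
     \<lparr>carrier = carrier M \<rightarrow>\<^sub>E carrier K,
      mult = (\<lambda>f g. \<lambda>x\<in>carrier M.
        (\<Oplus>\<^bsub>K\<^esub>p\<in>{(y, z) \<in> carrier M \<times> carrier M. y \<otimes>\<^bsub>M\<^esub> z = x}. f (fst p) \<otimes>\<^bsub>K\<^esub> g (snd p))),
      one = (\<lambda>x\<in>carrier M. if x = \<one>\<^bsub>M\<^esub> then \<one>\<^bsub>K\<^esub> else \<zero>\<^bsub>K\<^esub>),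
      zero = (\<lambda>x\<in>carrier M. \<zero>\<^bsub>K\<^esub>),
      add = (\<lambda>f g. \<lambda>x\<in>carrier M. f x \<oplus>\<^bsub>K\<^esub> g x),
      smult = (\<lambda>c f. \<lambda>x\<in>carrier M. c \<otimes>\<^bsub>K\<^esub> f x)\<rparr>"

text \<open>Meaningful only for a finite index set \<open>I\<close>: a HOL-Algebra sum over an infinite set is zero.\<close>

definition lin_span ::
    "('k, 'r) ring_scheme \<Rightarrow> ('k, 'a, 'q) module_scheme \<Rightarrow> 'i set \<Rightarrow> ('i \<Rightarrow> 'a) \<Rightarrow> 'a set" where
  "lin_span K A I b = {(\<Oplus>\<^bsub>A\<^esub>i\<in>I. c i \<odot>\<^bsub>A\<^esub> b i) | c. c \<in> I \<rightarrow> carrier K}"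

definition lin_basis ::
    "('k, 'r) ring_scheme \<Rightarrow> ('k, 'a, 'q) module_scheme \<Rightarrow> 'i set \<Rightarrow> ('i \<Rightarrow> 'a) \<Rightarrow> bool" where
  "lin_basis K A I b \<longleftrightarrow>
     b \<in> I \<rightarrow> carrier A \<and> inj_on b I \<and>
     lin_span K A I b = carrier A \<and>
     (\<forall>c\<in>I \<rightarrow> carrier K. (\<Oplus>\<^bsub>A\<^esub>i\<in>I. c i \<odot>\<^bsub>A\<^esub> b i) = \<zero>\<^bsub>A\<^esub> \<longrightarrow> (\<forall>i\<in>I. c i = \<zero>\<^bsub>K\<^esub>))"

text \<open>
  The order on \<open>\<Lambda>\<close> is given as the set \<open>leq\<close> of all pairs \<open>(l, m)\<close> with \<open>l \<le> m\<close>;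
  \<open>C l s t\<close> is the basis element with upper index \<open>l\<close>, left index \<open>s\<close> and right index \<open>t\<close>.
\<close>

definition cell_above ::
    "('k, 'r) ring_scheme \<Rightarrow> ('k, 'a, 'q) module_scheme \<Rightarrow> 'l set \<Rightarrow> 'l rel \<Rightarrow>
     ('l \<Rightarrow> 's set) \<Rightarrow> ('l \<Rightarrow> 't set) \<Rightarrow> ('l \<Rightarrow> 's \<Rightarrow> 't \<Rightarrow> 'a) \<Rightarrow> 'l \<Rightarrow> 'a set" where
  "cell_above K A \<Lambda> leq L R C l =
     lin_span K A (SIGMA m:{m \<in> \<Lambda>. (l, m) \<in> leq \<and> m \<noteq> l}. L m \<times> R m) (\<lambda>(m, s, t). C m s t)"

definition cell_structure ::
    "('k, 'r) ring_scheme \<Rightarrow> ('k, 'a, 'q) module_scheme \<Rightarrow> 'l set \<Rightarrow> 'l rel \<Rightarrow>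
     ('l \<Rightarrow> 's set) \<Rightarrow> ('l \<Rightarrow> 't set) \<Rightarrow> ('l \<Rightarrow> 's \<Rightarrow> 't \<Rightarrow> 'a) \<Rightarrow> bool" where
  "cell_structure K A \<Lambda> leq L R C \<longleftrightarrow>
     finite \<Lambda> \<and> partial_order_on \<Lambda> leq \<and>
     (\<forall>l\<in>\<Lambda>. finite (L l) \<and> finite (R l)) \<and>
     lin_basis K A (SIGMA l:\<Lambda>. L l \<times> R l) (\<lambda>(l, s, t). C l s t) \<and>
     (\<exists>r. \<forall>a\<in>carrier A. \<forall>l\<in>\<Lambda>. \<forall>s\<in>L l.
        (\<forall>s'\<in>L l. r a l s s' \<in> carrier K) \<and>
        (\<forall>t\<in>R l. a \<otimes>\<^bsub>A\<^esub> C l s t \<ominus>\<^bsub>A\<^esub> (\<Oplus>\<^bsub>A\<^esub>s'\<in>L l. r a l s s' \<odot>\<^bsub>A\<^esub> C l s' t)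
                  \<in> cell_above K A \<Lambda> leq L R C l)) \<and>
     (\<exists>r. \<forall>a\<in>carrier A. \<forall>l\<in>\<Lambda>. \<forall>t\<in>R l.
        (\<forall>t'\<in>R l. r a l t t' \<in> carrier K) \<and>
        (\<forall>s\<in>L l. C l s t \<otimes>\<^bsub>A\<^esub> a \<ominus>\<^bsub>A\<^esub> (\<Oplus>\<^bsub>A\<^esub>t'\<in>R l. r a l t t' \<odot>\<^bsub>A\<^esub> C l s t')
                  \<in> cell_above K A \<Lambda> leq L R C l))"

text \<open>All index sets are finite, so taking them to be sets of natural numbers loses nothing.\<close>

definition has_cell_algebra_structure ::
    "('k, 'r) ring_scheme \<Rightarrow> ('k, 'a, 'q) module_scheme \<Rightarrow> bool" where
  "has_cell_algebra_structure K A \<longleftrightarrow>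
     assoc_algebra K A \<and>
     (\<exists>(\<Lambda> :: nat set) leq (L :: nat \<Rightarrow> nat set) (R :: nat \<Rightarrow> nat set) C.
        cell_structure K A \<Lambda> leq L R C)"

definition CA_condition :: "('k, 'r) ring_scheme \<Rightarrow> ('m, 's) monoid_scheme \<Rightarrow> bool" where
  "CA_condition K M \<longleftrightarrow>
     (\<forall>D\<in>D_classes M. has_cell_algebra_structure K (monoid_algebra K (schutzenberger_group M D)))"

definition left_ideal :: "'a set \<Rightarrow> ('a, 'q) ring_scheme \<Rightarrow> bool" where
  "left_ideal I A \<longleftrightarrow>
     additive_subgroup I A \<and> (\<forall>a\<in>carrier A. \<forall>x\<in>I. a \<otimes>\<^bsub>A\<^esub> x \<in> I)"

definition minimal_left_ideal :: "'a set \<Rightarrow> ('a, 'q) ring_scheme \<Rightarrow> bool" where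
  "minimal_left_ideal I A \<longleftrightarrow>
     left_ideal I A \<and> I \<noteq> {\<zero>\<^bsub>A\<^esub>} \<and>
     (\<forall>J. left_ideal J A \<and> J \<subseteq> I \<longrightarrow> J = {\<zero>\<^bsub>A\<^esub>} \<or> J = I)"

text \<open>
  A ring is semisimple if its left regular module is a direct sum of simple submodules, i.e. if
  there is a set of minimal left ideals such that each element of the ring is in a unique way a
  finitely supported sum of elements of these ideals.
\<close>

definition semisimple_ring :: "('a, 'q) ring_scheme \<Rightarrow> bool" where
  "semisimple_ring A \<longleftrightarrow>
     ring A \<and>
     (\<exists>\<I>. (\<forall>I\<in>\<I>. minimal_left_ideal I A) \<and>
        (\<forall>a\<in>carrier A. \<exists>!f. f \<in> (\<Pi>\<^sub>E I\<in>\<I>. I) \<and> finite {I \<in> \<I>. f I \<noteq> \<zero>\<^bsub>A\<^esub>} \<and>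
           a = (\<Oplus>\<^bsub>A\<^esub>I\<in>{I \<in> \<I>. f I \<noteq> \<zero>\<^bsub>A\<^esub>}. f I)))"

end

theory Submission
  imports Defs
begin

text \<open>
  Both sides of the equivalence say that the sizes of the H-classes of \<open>M\<close> are invertible in the
  field \<open>K\<close>.

  An element \<open>x\<close> of an inverse monoid is an arrow from the idempotent \<open>x\<^sup>\<star> \<otimes> x\<close> to the idempotent
  \<open>x \<otimes> x\<^sup>\<star>\<close> of a groupoid whose hom-sets are the H-classes and whose connected components are the
  D-classes.  Moebius inversion along the natural partial order gives a basis of \<open>K[M]\<close> that
  multiplies like the arrows of this groupoid, with product zero for arrows that do not compose
  (\<open>mob_mult\<close>).  In this basis the two halves of Maschke's theorem can be carried out.

  If the size of an H-class vanishes in \<open>K\<close>, the sum of its arrows is a nonzero \<open>x\<close> with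
  \<open>x \<otimes> f \<otimes> x = \<zero>\<close> for all \<open>f\<close>, which is impossible in a semisimple ring
  (\<open>semisimple_imp_semiprime\<close>, \<open>semisimple_imp_card_hclass\<close>).  If all these sizes are invertible,
  averaging a linear projection onto a left ideal \<open>N\<close> gives an element of \<open>N\<close> that is a right unit
  on \<open>N\<close> (\<open>left_ideal_right_unit\<close>), and a ring in which all left ideals have such elements is
  semisimple (\<open>semisimple_ring_if_left_ideals_idempotent_generated\<close>).

  So \<open>K[M]\<close> is semisimple if and only if all sizes of H-classes are invertible in \<open>K\<close>
  (\<open>semisimple_iff_card_hclass\<close>).  This applies to the group of a D-class as well, as a group is an
  inverse monoid with a single H-class.  That group has as many elements as any H-class in the
  D-class (\<open>card_schutzenberger_of\<close>, \<open>card_hclass_D\<close>), so the two criteria coincide.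
\<close>

section \<open>Semisimple rings\<close>

lemma (in ring) left_idealI:
  assumes "I \<subseteq> carrier R" "\<zero> \<in> I"
    and "\<And>x y. x \<in> I \<Longrightarrow> y \<in> I \<Longrightarrow> x \<oplus> y \<in> I"
    and mult: "\<And>a x. a \<in> carrier R \<Longrightarrow> x \<in> I \<Longrightarrow> a \<otimes> x \<in> I"
  shows "left_ideal I R"
proof -
  have "\<ominus> x \<in> I" if "x \<in> I" for x
    using mult[of "\<ominus> \<one>" x] that assms(1) by (simp add: l_minus subset_iff)
  then have "additive_subgroup I R"
    using assms by (intro additive_subgroup.intro add.subgroupI) (auto simp: a_inv_def)
  with mult show ?thesis unfolding left_ideal_def by blast
qed

context ring
begin

lemma left_ideal_carrier: "left_ideal I R \<Longrightarrow> x \<in> I \<Longrightarrow> x \<in> carrier R"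
  and left_ideal_zero: "left_ideal I R \<Longrightarrow> \<zero> \<in> I"
  and left_ideal_add: "left_ideal I R \<Longrightarrow> x \<in> I \<Longrightarrow> y \<in> I \<Longrightarrow> x \<oplus> y \<in> I"
  and left_ideal_uminus: "left_ideal I R \<Longrightarrow> x \<in> I \<Longrightarrow> \<ominus> x \<in> I"
  and left_ideal_mult: "left_ideal I R \<Longrightarrow> a \<in> carrier R \<Longrightarrow> x \<in> I \<Longrightarrow> a \<otimes> x \<in> I"
  unfolding left_ideal_def
  using additive_subgroup.a_subset[of I R] additive_subgroup.zero_closed[of I R]
    additive_subgroup.a_closed[of I R x y] additive_subgroup.a_inv_closed[of I R x]
  by auto

lemma eq_if_minus_zero:
  assumes "x \<in> carrier R" "y \<in> carrier R" "x \<ominus> y = \<zero>"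
  shows "x = y"
  using assms minus_equality[of x "\<ominus> y"] minus_minus[of y] unfolding a_minus_def by simp

lemma left_ideal_finsum:
  assumes "left_ideal I R" "\<And>i. i \<in> F \<Longrightarrow> f i \<in> I"
  shows "(\<Oplus>i\<in>F. f i) \<in> I"
  using assms(2)
proof (induction F rule: infinite_finite_induct)
  case (insert i F)
  then have "f \<in> F \<rightarrow> carrier R" "f i \<in> carrier R"
    using left_ideal_carrier[OF assms(1)] by auto
  then show ?case using insert left_ideal_add[OF assms(1)] by simp
qed (use left_ideal_zero[OF assms(1)] in auto)

lemma left_ideal_principal:
  assumes "x \<in> carrier R"
  shows "left_ideal ((\<lambda>a. a \<otimes> x) ` carrier R) R"
proof (rule left_idealI)
  show "\<zero> \<in> (\<lambda>a. a \<otimes> x) ` carrier R"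
    using assms by (intro image_eqI[of _ _ \<zero>]) auto
  fix u v assume "u \<in> (\<lambda>a. a \<otimes> x) ` carrier R" "v \<in> (\<lambda>a. a \<otimes> x) ` carrier R"
  then obtain a b where "u = a \<otimes> x" "v = b \<otimes> x" "a \<in> carrier R" "b \<in> carrier R" by auto
  then show "u \<oplus> v \<in> (\<lambda>a. a \<otimes> x) ` carrier R"
    using assms by (intro image_eqI[of _ _ "a \<oplus> b"]) (auto simp: l_distr)
next
  fix a u assume "a \<in> carrier R" "u \<in> (\<lambda>a. a \<otimes> x) ` carrier R"
  then show "a \<otimes> u \<in> (\<lambda>a. a \<otimes> x) ` carrier R"
    using assms by (auto simp: m_assoc[symmetric])
qed (use assms in auto)

text \<open>
  A semisimple ring is semiprime.  If \<open>x \<noteq> \<zero>\<close>, then \<open>x\<close> does not annihilate all minimal left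
  ideals, as these sum up to the ring.  If \<open>x \<otimes> f \<noteq> \<zero>\<close> with \<open>f\<close> in the minimal left ideal \<open>I\<close>, then
  the nonzero left ideal generated by \<open>x \<otimes> f\<close> is all of \<open>I\<close>, so that \<open>f = a \<otimes> x \<otimes> f\<close> for some \<open>a\<close>;
  but then \<open>x \<otimes> f = x \<otimes> a \<otimes> x \<otimes> f\<close> contradicts \<open>x \<otimes> a \<otimes> x = \<zero>\<close>.
\<close>

lemma semisimple_imp_semiprime:
  assumes ss: "semisimple_ring R" and x: "x \<in> carrier R"
    and null: "\<And>a. a \<in> carrier R \<Longrightarrow> x \<otimes> a \<otimes> x = \<zero>"
  shows "x = \<zero>"
proof (rule ccontr)
  assume "x \<noteq> \<zero>"
  obtain \<I> where min: "\<And>I. I \<in> \<I> \<Longrightarrow> minimal_left_ideal I R"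
    and dec: "\<forall>a\<in>carrier R. \<exists>!f. f \<in> (\<Pi>\<^sub>E I\<in>\<I>. I) \<and> finite {I \<in> \<I>. f I \<noteq> \<zero>} \<and>
           a = (\<Oplus>I\<in>{I \<in> \<I>. f I \<noteq> \<zero>}. f I)"
    using ss unfolding semisimple_ring_def by blast
  obtain f where f: "f \<in> (\<Pi>\<^sub>E I\<in>\<I>. I)" and fin: "finite {I \<in> \<I>. f I \<noteq> \<zero>}"
    and sum: "\<one> = (\<Oplus>I\<in>{I \<in> \<I>. f I \<noteq> \<zero>}. f I)"
    using dec by blast
  have li: "left_ideal I R" if "I \<in> \<I>" for I
    using min[OF that] unfolding minimal_left_ideal_def by blast
  have fI: "f I \<in> I" if "I \<in> \<I>" for I
    using f that by (auto simp: PiE_iff)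
  have fc: "f I \<in> carrier R" if "I \<in> \<I>" for I
    using left_ideal_carrier[OF li fI] that by blast
  have "x = x \<otimes> (\<Oplus>I\<in>{I \<in> \<I>. f I \<noteq> \<zero>}. f I)"
    using sum x by (metis r_one)
  also have "\<dots> = (\<Oplus>I\<in>{I \<in> \<I>. f I \<noteq> \<zero>}. x \<otimes> f I)"
    using fin x fc by (intro finsum_rdistr) auto
  finally have "(\<Oplus>I\<in>{I \<in> \<I>. f I \<noteq> \<zero>}. x \<otimes> f I) \<noteq> \<zero>"
    using \<open>x \<noteq> \<zero>\<close> by simp
  then obtain I where I: "I \<in> \<I>" and ne: "x \<otimes> f I \<noteq> \<zero>"
    using add.finprod_one_eqI[of "{I \<in> \<I>. f I \<noteq> \<zero>}" "\<lambda>I. x \<otimes> f I"] by auto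
  define J where "J = (\<lambda>a. a \<otimes> (x \<otimes> f I)) ` carrier R"
  have c: "x \<otimes> f I \<in> carrier R" using x fc[OF I] by simp
  have "left_ideal J R"
    unfolding J_def using left_ideal_principal[OF c] .
  moreover have "J \<subseteq> I"
    unfolding J_def using x left_ideal_mult[OF li[OF I]] fI[OF I] by auto
  moreover have "x \<otimes> f I \<in> J"
    unfolding J_def using c by (intro image_eqI[of _ _ \<one>]) auto
  ultimately have "J = I"
    using min[OF I] ne unfolding minimal_left_ideal_def by blast
  then obtain a where a: "a \<in> carrier R" "f I = a \<otimes> (x \<otimes> f I)"
    using fI[OF I] unfolding J_def by blast
  have "x \<otimes> f I = x \<otimes> (a \<otimes> (x \<otimes> f I))" using a(2) by simp
  also have "\<dots> = x \<otimes> a \<otimes> x \<otimes> f I"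
    using a(1) x fc[OF I] by (simp add: m_assoc)
  finally show False using ne null[OF a(1)] fc[OF I] by simp
qed

text \<open>
  Finite subfamilies suffice, as sums are finite; this makes independence a property of finite
  character, to which Zorn's lemma applies.
\<close>

definition independent_ideals :: "'a set set \<Rightarrow> bool" where
  "independent_ideals \<I> \<longleftrightarrow>
     (\<forall>F f. finite F \<and> F \<subseteq> \<I> \<and> f \<in> (\<Pi> I\<in>F. I) \<and> (\<Oplus>I\<in>F. f I) = \<zero> \<longrightarrow> (\<forall>I\<in>F. f I = \<zero>))"

definition sum_of_ideals :: "'a set set \<Rightarrow> 'a set" where
  "sum_of_ideals \<I> = {(\<Oplus>I\<in>F. f I) | F f. finite F \<and> F \<subseteq> \<I> \<and> f \<in> (\<Pi> I\<in>F. I)}"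

lemma left_ideal_sum_of_ideals:
  assumes li: "\<And>I. I \<in> \<I> \<Longrightarrow> left_ideal I R"
  shows "left_ideal (sum_of_ideals \<I>) R"
proof (rule left_idealI)
  have c: "f \<in> F \<rightarrow> carrier R" if "F \<subseteq> \<I>" "f \<in> (\<Pi> I\<in>F. I)" for F f
    using that left_ideal_carrier[OF li] by (auto simp: Pi_iff subset_iff)
  show "sum_of_ideals \<I> \<subseteq> carrier R"
    unfolding sum_of_ideals_def using c by (auto intro!: finsum_closed)
  show "\<zero> \<in> sum_of_ideals \<I>"
    unfolding sum_of_ideals_def by (auto intro!: exI[of _ "{}"])
  fix u v assume "u \<in> sum_of_ideals \<I>" "v \<in> sum_of_ideals \<I>"
  then obtain F f G g where F: "finite F" "F \<subseteq> \<I>" "f \<in> (\<Pi> I\<in>F. I)" "u = (\<Oplus>I\<in>F. f I)"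
    and G: "finite G" "G \<subseteq> \<I>" "g \<in> (\<Pi> I\<in>G. I)" "v = (\<Oplus>I\<in>G. g I)"
    unfolding sum_of_ideals_def by blast
  define f' where "f' I = (if I \<in> F then f I else \<zero>)" for I
  define g' where "g' I = (if I \<in> G then g I else \<zero>)" for I
  have f': "f' \<in> (\<Pi> I\<in>F \<union> G. I)" and g': "g' \<in> (\<Pi> I\<in>F \<union> G. I)"
    unfolding f'_def g'_def using F G left_ideal_zero[OF li] by (auto simp: Pi_iff subset_iff)
  have "u = (\<Oplus>I\<in>F \<union> G. f' I)"
    unfolding F(4) using F G c[OF F(2,3)] c[OF _ f'] 
    by (intro add.finprod_mono_neutral_cong_left) (auto simp: f'_def)
  moreover have "v = (\<Oplus>I\<in>F \<union> G. g' I)"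
    unfolding G(4) using F G c[OF G(2,3)] c[OF _ g']
    by (intro add.finprod_mono_neutral_cong_left) (auto simp: g'_def)
  ultimately have "u \<oplus> v = (\<Oplus>I\<in>F \<union> G. f' I \<oplus> g' I)"
    using c[OF _ f'] c[OF _ g'] F G by (simp add: finsum_addf)
  moreover have "(\<lambda>I. f' I \<oplus> g' I) \<in> (\<Pi> I\<in>F \<union> G. I)"
    using f' g' F G left_ideal_add[OF li] by (auto simp: Pi_iff subset_iff)
  ultimately show "u \<oplus> v \<in> sum_of_ideals \<I>"
    unfolding sum_of_ideals_def using F G by (auto intro!: exI[of _ "F \<union> G"])
next
  fix a u assume a: "a \<in> carrier R" and "u \<in> sum_of_ideals \<I>"
  then obtain F f where F: "finite F" "F \<subseteq> \<I>" "f \<in> (\<Pi> I\<in>F. I)" "u = (\<Oplus>I\<in>F. f I)"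
    unfolding sum_of_ideals_def by blast
  have "f \<in> F \<rightarrow> carrier R"
    using F left_ideal_carrier[OF li] by (auto simp: Pi_iff subset_iff)
  then have "a \<otimes> u = (\<Oplus>I\<in>F. a \<otimes> f I)"
    unfolding F(4) using a F(1) by (intro finsum_rdistr)
  moreover have "(\<lambda>I. a \<otimes> f I) \<in> (\<Pi> I\<in>F. I)"
    using F a left_ideal_mult[OF li] by (auto simp: Pi_iff subset_iff)
  ultimately show "a \<otimes> u \<in> sum_of_ideals \<I>"
    unfolding sum_of_ideals_def using F by blast
qed

lemma ideal_subset_sum_of_ideals:
  assumes "I \<in> \<I>" "left_ideal I R"
  shows "I \<subseteq> sum_of_ideals \<I>"
proof
  fix x assume "x \<in> I"
  then have "(\<Oplus>J\<in>{I}. (\<lambda>_. x) J) = x" "(\<lambda>_. x) \<in> (\<Pi> J\<in>{I}. J)"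
    using left_ideal_carrier[OF assms(2)] by auto
  then show "x \<in> sum_of_ideals \<I>"
    unfolding sum_of_ideals_def using assms(1)
    by (intro CollectI exI[of _ "{I}"] exI[of _ "\<lambda>_. x"]) auto
qed

text \<open>
  Multiplying a decomposition of \<open>\<one>\<close> by \<open>a\<close> from the left decomposes \<open>a\<close>.  Uniqueness is independence
  applied to the difference of two decompositions.
\<close>

lemma semisimple_ring_if_independent_sum:
  assumes min: "\<And>I. I \<in> \<I> \<Longrightarrow> minimal_left_ideal I R"
    and ind: "independent_ideals \<I>" and one: "\<one> \<in> sum_of_ideals \<I>"
  shows "semisimple_ring R"
  unfolding semisimple_ring_def
proof (intro conjI exI[of _ \<I>] ballI)
  show "ring R" ..
  have li: "left_ideal I R" if "I \<in> \<I>" for I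
    using min[OF that] unfolding minimal_left_ideal_def by blast
  fix a assume a: "a \<in> carrier R"
  have "a \<otimes> \<one> \<in> sum_of_ideals \<I>"
    using left_ideal_mult[OF left_ideal_sum_of_ideals[OF li] a one] by simp
  then obtain F f where F: "finite F" "F \<subseteq> \<I>" "f \<in> (\<Pi> I\<in>F. I)" "a = (\<Oplus>I\<in>F. f I)"
    unfolding sum_of_ideals_def using a by auto
  have c: "g I \<in> carrier R" if "g \<in> (\<Pi>\<^sub>E I\<in>\<I>. I)" "I \<in> \<I>" for g I
    using that left_ideal_carrier[OF li] by (auto simp: PiE_iff)
  show "\<exists>!f. f \<in> (\<Pi>\<^sub>E I\<in>\<I>. I) \<and> finite {I \<in> \<I>. f I \<noteq> \<zero>} \<and>
           a = (\<Oplus>I\<in>{I \<in> \<I>. f I \<noteq> \<zero>}. f I)"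
  proof (rule ex_ex1I)
    define f' where "f' = (\<lambda>I\<in>\<I>. if I \<in> F then f I else \<zero>)"
    have f': "f' \<in> (\<Pi>\<^sub>E I\<in>\<I>. I)"
      unfolding f'_def using F left_ideal_zero[OF li] by (auto simp: Pi_iff)
    have sub: "{I \<in> \<I>. f' I \<noteq> \<zero>} \<subseteq> F" unfolding f'_def by auto
    have "f \<in> F \<rightarrow> carrier R"
      using F left_ideal_carrier[OF li] by (auto simp: Pi_iff subset_iff)
    moreover have "f I = \<zero>" if "I \<in> F" "f' I = \<zero>" for I
      using that F(2) unfolding f'_def by (auto simp: subset_iff)
    ultimately have "(\<Oplus>I\<in>{I \<in> \<I>. f' I \<noteq> \<zero>}. f' I) = (\<Oplus>I\<in>F. f I)"
      using F(1,2) sub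
      by (intro add.finprod_mono_neutral_cong_left) (auto simp: f'_def)
    then show "\<exists>f. f \<in> (\<Pi>\<^sub>E I\<in>\<I>. I) \<and> finite {I \<in> \<I>. f I \<noteq> \<zero>} \<and>
           a = (\<Oplus>I\<in>{I \<in> \<I>. f I \<noteq> \<zero>}. f I)"
      using f' finite_subset[OF sub F(1)] F(4) by (intro exI[of _ f'] conjI) auto
  next
    fix g h
    assume g: "g \<in> (\<Pi>\<^sub>E I\<in>\<I>. I) \<and> finite {I \<in> \<I>. g I \<noteq> \<zero>} \<and>
           a = (\<Oplus>I\<in>{I \<in> \<I>. g I \<noteq> \<zero>}. g I)"
      and h: "h \<in> (\<Pi>\<^sub>E I\<in>\<I>. I) \<and> finite {I \<in> \<I>. h I \<noteq> \<zero>} \<and>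
           a = (\<Oplus>I\<in>{I \<in> \<I>. h I \<noteq> \<zero>}. h I)"
    define U where "U = {I \<in> \<I>. g I \<noteq> \<zero>} \<union> {I \<in> \<I>. h I \<noteq> \<zero>}"
    have U: "finite U" "U \<subseteq> \<I>" unfolding U_def using g h by auto
    have gc: "g \<in> U \<rightarrow> carrier R" and hc: "h \<in> U \<rightarrow> carrier R"
      using c g h U(2) by auto
    have "(\<Oplus>I\<in>U. g I) = a"
      using g U gc by (subst conjunct2[OF conjunct2[OF g]], intro add.finprod_mono_neutral_cong_right)
        (auto simp: U_def)
    moreover have "(\<Oplus>I\<in>U. h I) = a"
      using h U hc by (subst conjunct2[OF conjunct2[OF h]], intro add.finprod_mono_neutral_cong_right)
        (auto simp: U_def)
    moreover have "(\<Oplus>I\<in>U. \<ominus> \<one> \<otimes> h I) = \<ominus> \<one> \<otimes> (\<Oplus>I\<in>U. h I)"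
      using U(1) hc by (intro finsum_rdistr[symmetric]) auto
    moreover have "(\<Oplus>I\<in>U. g I \<oplus> \<ominus> \<one> \<otimes> h I) = (\<Oplus>I\<in>U. g I) \<oplus> (\<Oplus>I\<in>U. \<ominus> \<one> \<otimes> h I)"
      using gc hc by (intro finsum_addf) (auto simp: Pi_iff)
    ultimately have "(\<Oplus>I\<in>U. g I \<oplus> \<ominus> \<one> \<otimes> h I) = \<zero>"
      using a by (simp add: l_minus r_neg)
    moreover have "(\<lambda>I. g I \<oplus> \<ominus> \<one> \<otimes> h I) \<in> (\<Pi> I\<in>U. I)"
    proof
      fix I assume "I \<in> U"
      then have I: "I \<in> \<I>" using U(2) by blast
      then have "g I \<in> I" "h I \<in> I" using g h by (auto simp: PiE_iff)
      then show "g I \<oplus> \<ominus> \<one> \<otimes> h I \<in> I"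
        using left_ideal_add[OF li[OF I]] left_ideal_mult[OF li[OF I]] by simp
    qed
    ultimately have z: "g I \<oplus> \<ominus> \<one> \<otimes> h I = \<zero>" if "I \<in> U" for I
      using ind U that unfolding independent_ideals_def by blast
    have "g I = h I" if "I \<in> \<I>" for I
    proof (cases "I \<in> U")
      case True
      have "g I \<in> carrier R" "h I \<in> carrier R" using c g h that by auto
      then show ?thesis using z[OF True] eq_if_minus_zero[of "g I" "h I"]
        by (simp add: l_minus a_minus_def)
    next
      case False
      then show ?thesis using that unfolding U_def by simp
    qed
    then show "g = h" using PiE_ext[OF conjunct1[OF g] conjunct1[OF h]] by blast
  qed
qed (use min in blast)

lemma ex_maximal_left_ideal:
  assumes S: "left_ideal S R" "\<one> \<notin> S"
  obtains N where "left_ideal N R" "S \<subseteq> N" "\<one> \<notin> N"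
    "\<And>J. left_ideal J R \<Longrightarrow> N \<subset> J \<Longrightarrow> \<one> \<in> J"
proof -
  define \<A> where "\<A> = {J. left_ideal J R \<and> S \<subseteq> J \<and> \<one> \<notin> J}"
  have "\<exists>N\<in>\<A>. \<forall>X\<in>\<A>. N \<subseteq> X \<longrightarrow> X = N"
  proof (rule subset_Zorn_nonempty)
    show "\<A> \<noteq> {}" unfolding \<A>_def using S by blast
    fix \<C> assume ne: "\<C> \<noteq> {}" and ch: "subset.chain \<A> \<C>"
    have li: "\<And>J. J \<in> \<C> \<Longrightarrow> left_ideal J R"
      using ch unfolding subset.chain_def \<A>_def by blast
    have "left_ideal (\<Union>\<C>) R"
    proof (rule left_idealI)
      fix x y assume "x \<in> \<Union>\<C>" "y \<in> \<Union>\<C>"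
      then obtain X Y where XY: "X \<in> \<C>" "Y \<in> \<C>" "x \<in> X" "y \<in> Y" by blast
      then have "X \<subseteq> Y \<or> Y \<subseteq> X" using subset.chain_total[OF ch] by blast
      then show "x \<oplus> y \<in> \<Union>\<C>"
        using XY left_ideal_add[OF li[of X]] left_ideal_add[OF li[of Y]] by blast
    qed (use li left_ideal_carrier left_ideal_zero left_ideal_mult ne in blast)+
    then show "\<Union>\<C> \<in> \<A>"
      using ch ne unfolding subset.chain_def \<A>_def by blast
  qed
  then obtain N where N: "N \<in> \<A>" and max: "\<And>X. X \<in> \<A> \<Longrightarrow> N \<subseteq> X \<Longrightarrow> X = N" by blast
  show ?thesis
  proof (rule that)
    show "left_ideal N R" "S \<subseteq> N" "\<one> \<notin> N" using N unfolding \<A>_def by auto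
    show "\<one> \<in> J" if "left_ideal J R" "N \<subset> J" for J
      using max[of J] N that unfolding \<A>_def by blast
  qed
qed

text \<open>
  The left annihilator of the idempotent \<open>e\<close> is a complement of \<open>N\<close>.  It is minimal by the modular
  law, as \<open>N\<close> and a nonzero left ideal inside the complement together generate the ring.
\<close>

lemma maximal_left_ideal_complement:
  assumes N: "left_ideal N R" "\<one> \<notin> N" and e: "e \<in> N" "\<And>x. x \<in> N \<Longrightarrow> x \<otimes> e = x"
    and max: "\<And>J. left_ideal J R \<Longrightarrow> N \<subset> J \<Longrightarrow> \<one> \<in> J"
  obtains N' where "minimal_left_ideal N' R" "N \<inter> N' = {\<zero>}"
proof
  define N' where "N' = {a \<in> carrier R. a \<otimes> e = \<zero>}"
  have ec: "e \<in> carrier R" using left_ideal_carrier[OF N(1) e(1)] .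
  have li: "left_ideal N' R"
    unfolding N'_def using ec by (intro left_idealI) (auto simp: l_distr m_assoc)
  have disj: "N \<inter> N' \<subseteq> {\<zero>}" unfolding N'_def using e(2) by force
  then show "N \<inter> N' = {\<zero>}"
    using left_ideal_zero[OF N(1)] left_ideal_zero[OF li] by blast
  have "\<one> \<ominus> e \<in> N'"
    unfolding N'_def using ec e(2)[OF e(1)] by (simp add: a_minus_def l_distr l_minus r_neg)
  moreover have "\<one> \<ominus> e \<noteq> \<zero>"
    using N(2) e(1) ec by (metis eq_if_minus_zero one_closed)
  ultimately have ne: "N' \<noteq> {\<zero>}" by blast
  show "minimal_left_ideal N' R"
    unfolding minimal_left_ideal_def
  proof (intro conjI allI impI li ne)
    fix J assume "left_ideal J R \<and> J \<subseteq> N'"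
    then have J: "left_ideal J R" "J \<subseteq> N'" by auto
    show "J = {\<zero>} \<or> J = N'"
    proof (cases "J = {\<zero>}")
      case False
      then obtain j where j: "j \<in> J" "j \<noteq> \<zero>" using left_ideal_zero[OF J(1)] by blast
      define T where "T = {n \<oplus> j | n j. n \<in> N \<and> j \<in> J}"
      have "left_ideal T R"
      proof (rule left_idealI)
        show "T \<subseteq> carrier R"
          unfolding T_def using left_ideal_carrier N(1) J(1) by blast
        show "\<zero> \<in> T"
          unfolding T_def using left_ideal_zero[OF N(1)] left_ideal_zero[OF J(1)] l_zero[of \<zero>] by force
        fix u v assume "u \<in> T" "v \<in> T"
        then obtain n j n' j' where *: "u = n \<oplus> j" "v = n' \<oplus> j'" "n \<in> N" "n' \<in> N" "j \<in> J" "j' \<in> J"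
          unfolding T_def by blast
        then have "u \<oplus> v = (n \<oplus> n') \<oplus> (j \<oplus> j')"
          using left_ideal_carrier[OF N(1)] left_ideal_carrier[OF J(1)] by (simp add: a_ac)
        then show "u \<oplus> v \<in> T"
          unfolding T_def using * left_ideal_add N(1) J(1) by blast
      next
        fix a u assume a: "a \<in> carrier R" "u \<in> T"
        then obtain n j where *: "u = n \<oplus> j" "n \<in> N" "j \<in> J" unfolding T_def by blast
        then have "a \<otimes> u = a \<otimes> n \<oplus> a \<otimes> j"
          using a left_ideal_carrier[OF N(1)] left_ideal_carrier[OF J(1)] by (simp add: r_distr)
        then show "a \<otimes> u \<in> T"
          unfolding T_def using * a left_ideal_mult N(1) J(1) by blast
      qed
      moreover have "N \<subseteq> T"
        unfolding T_def using left_ideal_zero[OF J(1)] left_ideal_carrier[OF N(1)] r_zero by force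
      moreover have "j \<in> T"
        unfolding T_def using left_ideal_zero[OF N(1)] left_ideal_carrier[OF J(1)] l_zero j(1) by force
      moreover have "j \<notin> N" using j J(2) disj by blast
      ultimately have "\<one> \<in> T" using max by blast
      then obtain n i where ni: "n \<in> N" "i \<in> J" "\<one> = n \<oplus> i" unfolding T_def by blast
      have nc: "n \<in> carrier R" and ic: "i \<in> carrier R"
        using ni left_ideal_carrier N(1) J(1) by blast+
      have "N' \<subseteq> J"
      proof
        fix x assume x: "x \<in> N'"
        have xc: "x \<in> carrier R" using left_ideal_carrier[OF li x] .
        have eq: "x = x \<otimes> n \<oplus> x \<otimes> i"
          using xc nc ic ni(3) by (metis r_distr r_one)
        have xi: "x \<otimes> i \<in> J" using left_ideal_mult[OF J(1) xc ni(2)] .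
        have "x \<otimes> n = x \<oplus> \<ominus> (x \<otimes> i)"
          using xc nc ic by (subst eq) (simp add: a_assoc r_neg)
        also have "\<dots> \<in> N'"
          using left_ideal_add[OF li x] left_ideal_uminus[OF li] xi J(2) by blast
        finally have "x \<otimes> n \<in> N'" .
        then have "x \<otimes> n = \<zero>" using left_ideal_mult[OF N(1) xc ni(1)] disj by blast
        then have "x = x \<otimes> i" using eq xc ic by simp
        then show "x \<in> J" using xi by simp
      qed
      then show ?thesis using J(2) by blast
    qed simp
  qed
qed

text \<open>
  \<open>N\<close> contains every sum over \<open>\<I>\<close>, so in a vanishing sum the term from \<open>N'\<close> lies in \<open>N \<inter> N'\<close>.
\<close>

lemma independent_ideals_insert:
  assumes ind: "independent_ideals \<I>" and li: "\<And>I. I \<in> \<I> \<Longrightarrow> left_ideal I R" "left_ideal N' R"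
    and N: "left_ideal N R" "\<And>I. I \<in> \<I> \<Longrightarrow> I \<subseteq> N" "N \<inter> N' = {\<zero>}"
  shows "independent_ideals (insert N' \<I>)"
  unfolding independent_ideals_def
proof (intro allI impI, elim conjE)
  fix F f assume F: "finite F" "F \<subseteq> insert N' \<I>" "f \<in> (\<Pi> I\<in>F. I)" "(\<Oplus>I\<in>F. f I) = \<zero>"
  have c: "f I \<in> carrier R" if "I \<in> F" for I
    using that F(2,3) left_ideal_carrier li by (metis PiE funcset_mem insertE subsetD)
  show "\<forall>I\<in>F. f I = \<zero>"
  proof (cases "N' \<in> F")
    case True
    define G where "G = F - {N'}"
    have G: "F = insert N' G" "N' \<notin> G" "finite G" "G \<subseteq> \<I>" "f \<in> (\<Pi> I\<in>G. I)"
      unfolding G_def using True F by auto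
    have s: "(\<Oplus>I\<in>G. f I) \<in> N"
      using G N(2) by (intro left_ideal_finsum[OF N(1)]) (auto simp: Pi_iff)
    have "(\<Oplus>I\<in>F. f I) = f N' \<oplus> (\<Oplus>I\<in>G. f I)"
      unfolding G(1) using G c by (intro finsum_insert) auto
    then have eq: "f N' \<oplus> (\<Oplus>I\<in>G. f I) = \<zero>" using F(4) by simp
    then have "f N' = \<ominus> (\<Oplus>I\<in>G. f I)"
      using c[OF True] left_ideal_carrier[OF N(1) s] by (metis minus_equality)
    then have "f N' \<in> N \<inter> N'"
      using left_ideal_uminus[OF N(1) s] F(3) True by (auto simp: Pi_iff)
    then have z: "f N' = \<zero>" using N(3) by blast
    then have "(\<Oplus>I\<in>G. f I) = \<zero>" using eq left_ideal_carrier[OF N(1) s] by simp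
    then show ?thesis using ind G z unfolding independent_ideals_def by blast
  next
    case False
    then show ?thesis using ind F unfolding independent_ideals_def by blast
  qed
qed

text \<open>
  By Zorn's lemma there is a maximal independent family of minimal left ideals.  Were its sum proper,
  it would lie in a maximal left ideal, whose minimal complement would extend the family.
\<close>

lemma semisimple_ring_if_left_ideals_idempotent_generated:
  assumes gen: "\<And>N. left_ideal N R \<Longrightarrow> \<exists>e\<in>N. \<forall>x\<in>N. x \<otimes> e = x"
  shows "semisimple_ring R"
proof -
  define \<A> where "\<A> = {\<I>. (\<forall>I\<in>\<I>. minimal_left_ideal I R) \<and> independent_ideals \<I>}"
  have "\<exists>M\<in>\<A>. \<forall>X\<in>\<A>. M \<subseteq> X \<longrightarrow> X = M"
  proof (rule subset_Zorn_nonempty)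
    show "\<A> \<noteq> {}" unfolding \<A>_def independent_ideals_def by (auto intro!: exI[of _ "{}"])
    fix \<C> assume ne: "\<C> \<noteq> {}" and ch: "subset.chain \<A> \<C>"
    have "independent_ideals (\<Union>\<C>)"
      unfolding independent_ideals_def
    proof (intro allI impI, elim conjE)
      fix F f assume F: "finite F" "F \<subseteq> \<Union>\<C>" "f \<in> (\<Pi> I\<in>F. I)" "(\<Oplus>I\<in>F. f I) = \<zero>"
      obtain \<I> where "\<I> \<in> \<C>" "F \<subseteq> \<I>"
        using finite_subset_Union_chain[OF F(1,2) ne ch] .
      then show "\<forall>I\<in>F. f I = \<zero>"
        using F ch unfolding subset.chain_def \<A>_def independent_ideals_def by blast
    qed
    then show "\<Union>\<C> \<in> \<A>"
      using ch unfolding subset.chain_def \<A>_def by blast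
  qed
  then obtain \<I> where min: "\<And>I. I \<in> \<I> \<Longrightarrow> minimal_left_ideal I R" and ind: "independent_ideals \<I>"
    and max: "\<And>X. (\<forall>I\<in>X. minimal_left_ideal I R) \<Longrightarrow> independent_ideals X \<Longrightarrow> \<I> \<subseteq> X \<Longrightarrow> X = \<I>"
    unfolding \<A>_def by (smt (verit, best) mem_Collect_eq)
  have li: "left_ideal I R" if "I \<in> \<I>" for I
    using min[OF that] unfolding minimal_left_ideal_def by blast
  have "\<one> \<in> sum_of_ideals \<I>"
  proof (rule ccontr)
    assume "\<one> \<notin> sum_of_ideals \<I>"
    then obtain N where N: "left_ideal N R" "sum_of_ideals \<I> \<subseteq> N" "\<one> \<notin> N"
      "\<And>J. left_ideal J R \<Longrightarrow> N \<subset> J \<Longrightarrow> \<one> \<in> J"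
      using ex_maximal_left_ideal[OF left_ideal_sum_of_ideals[OF li]] by blast
    obtain e where "e \<in> N" "\<And>x. x \<in> N \<Longrightarrow> x \<otimes> e = x" using gen[OF N(1)] by blast
    then obtain N' where N': "minimal_left_ideal N' R" "N \<inter> N' = {\<zero>}"
      using maximal_left_ideal_complement[OF N(1,3) _ _ N(4)] by metis
    have sub: "I \<subseteq> N" if "I \<in> \<I>" for I
      using ideal_subset_sum_of_ideals[OF that li[OF that]] N(2) by blast
    have li': "left_ideal N' R" "N' \<noteq> {\<zero>}" using N'(1) unfolding minimal_left_ideal_def by blast+
    have "independent_ideals (insert N' \<I>)"
      using independent_ideals_insert[OF ind li li'(1) N(1) sub N'(2)] .
    then have "insert N' \<I> = \<I>"
      using max[of "insert N' \<I>"] min N'(1) by blast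
    then have "N' \<subseteq> N" using sub by blast
    then show False using N'(2) li'(2) by blast
  qed
  then show ?thesis using semisimple_ring_if_independent_sum[OF min ind] by blast
qed

end

section \<open>Inverse monoids\<close>

locale inverse_monoid = monoid M for M (structure) +
  assumes inverse_semigroup: "inverse_semigroup M"
begin

definition sinv :: "'a \<Rightarrow> 'a" (\<open>_\<^sup>\<star>\<close> [1000] 1000) where
  "x\<^sup>\<star> = (THE y. y \<in> carrier M \<and> x \<otimes> y \<otimes> x = x \<and> y \<otimes> x \<otimes> y = y)"

lemma sinv_ex1:
  "x \<in> carrier M \<Longrightarrow> \<exists>!y. y \<in> carrier M \<and> x \<otimes> y \<otimes> x = x \<and> y \<otimes> x \<otimes> y = y"
  using inverse_semigroup unfolding inverse_semigroup_def by blast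

lemma sinv_props:
  assumes "x \<in> carrier M"
  shows sinv_closed [simp]: "x\<^sup>\<star> \<in> carrier M"
    and mult_sinv_mult: "x \<otimes> x\<^sup>\<star> \<otimes> x = x"
    and sinv_mult_sinv: "x\<^sup>\<star> \<otimes> x \<otimes> x\<^sup>\<star> = x\<^sup>\<star>"
  using theI'[OF sinv_ex1[OF assms]] unfolding sinv_def by auto

lemma sinv_unique:
  assumes "x \<in> carrier M" "y \<in> carrier M" "x \<otimes> y \<otimes> x = x" "y \<otimes> x \<otimes> y = y"
  shows "x\<^sup>\<star> = y"
  unfolding sinv_def using assms by (intro the1_equality[OF sinv_ex1]) auto

lemma sinv_sinv [simp]: "x \<in> carrier M \<Longrightarrow> x\<^sup>\<star>\<^sup>\<star> = x"
  by (intro sinv_unique) (auto simp: mult_sinv_mult sinv_mult_sinv)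

lemma sinv_idem:
  assumes "e \<in> carrier M" "e \<otimes> e = e"
  shows "e\<^sup>\<star> = e"
  using assms by (intro sinv_unique) auto

lemma sinv_assoc:
  assumes "x \<in> carrier M"
  shows "x \<otimes> (x\<^sup>\<star> \<otimes> x) = x" "x\<^sup>\<star> \<otimes> (x \<otimes> x\<^sup>\<star>) = x\<^sup>\<star>"
    and "z \<in> carrier M \<Longrightarrow> x \<otimes> (x\<^sup>\<star> \<otimes> (x \<otimes> z)) = x \<otimes> z"
    and "z \<in> carrier M \<Longrightarrow> x\<^sup>\<star> \<otimes> (x \<otimes> (x\<^sup>\<star> \<otimes> z)) = x\<^sup>\<star> \<otimes> z"
  using assms mult_sinv_mult[OF assms] sinv_mult_sinv[OF assms]
  by (simp_all add: m_assoc[symmetric])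

text \<open>
  Let \<open>x\<close> be the inverse of \<open>e \<otimes> f\<close>.  Then \<open>f \<otimes> x \<otimes> e\<close> is an idempotent, and it is inverse to
  \<open>e \<otimes> f\<close> as well, so it is \<open>x\<close>.  Hence \<open>e \<otimes> f\<close> is its own inverse \<open>x\<close>.
\<close>

lemma idem_mult_idem:
  assumes [simp]: "e \<in> carrier M" "f \<in> carrier M" and e: "e \<otimes> e = e" and f: "f \<otimes> f = f"
  shows "e \<otimes> f \<otimes> (e \<otimes> f) = e \<otimes> f"
proof -
  define x where "x = (e \<otimes> f)\<^sup>\<star>"
  have [simp]: "x \<in> carrier M" unfolding x_def by simp
  have e': "e \<otimes> (e \<otimes> z) = e \<otimes> z" and f': "f \<otimes> (f \<otimes> z) = f \<otimes> z" if "z \<in> carrier M" for z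
    using that e f by (simp_all add: m_assoc[symmetric])
  have x1: "e \<otimes> (f \<otimes> (x \<otimes> (e \<otimes> f))) = e \<otimes> f"
    using mult_sinv_mult[of "e \<otimes> f"] unfolding x_def[symmetric] by (simp add: m_assoc)
  have x2: "x \<otimes> (e \<otimes> (f \<otimes> (x \<otimes> z))) = x \<otimes> z" if "z \<in> carrier M" for z
    using sinv_mult_sinv[of "e \<otimes> f"] that unfolding x_def[symmetric] 
    by (simp add: m_assoc[symmetric])
  have "(e \<otimes> f)\<^sup>\<star> = f \<otimes> (x \<otimes> e)"
    by (intro sinv_unique) (simp_all add: m_assoc e' f' x1 x2)
  then have x3: "f \<otimes> (x \<otimes> e) = x" unfolding x_def by simp
  have "x \<otimes> x = f \<otimes> (x \<otimes> e) \<otimes> (f \<otimes> (x \<otimes> e))" by (simp only: x3)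
  also have "\<dots> = f \<otimes> (x \<otimes> e)" by (simp add: m_assoc x2)
  finally have xx: "x \<otimes> x = x" by (simp only: x3)
  then have "x\<^sup>\<star> = x" by (intro sinv_idem) auto
  then have "e \<otimes> f = x" unfolding x_def by simp
  then show ?thesis using xx by simp
qed

text \<open>
  Both \<open>e \<otimes> f\<close> and \<open>f \<otimes> e\<close> are idempotent, so \<open>f \<otimes> e\<close> is inverse to \<open>e \<otimes> f\<close>; but an idempotent is its
  own inverse.
\<close>

lemma idem_comm:
  assumes [simp]: "e \<in> carrier M" "f \<in> carrier M" and e: "e \<otimes> e = e" and f: "f \<otimes> f = f"
  shows "e \<otimes> f = f \<otimes> e"
proof -
  have e': "e \<otimes> (e \<otimes> z) = e \<otimes> z" and f': "f \<otimes> (f \<otimes> z) = f \<otimes> z" if "z \<in> carrier M" for z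
    using that e f by (simp_all add: m_assoc[symmetric])
  have ef: "e \<otimes> f \<otimes> (e \<otimes> f) = e \<otimes> f" and fe: "f \<otimes> e \<otimes> (f \<otimes> e) = f \<otimes> e"
    using idem_mult_idem e f by simp_all
  have "(e \<otimes> f)\<^sup>\<star> = f \<otimes> e"
    using ef fe by (intro sinv_unique) (simp_all add: m_assoc e' f')
  moreover have "(e \<otimes> f)\<^sup>\<star> = e \<otimes> f"
    using ef by (intro sinv_idem) simp_all
  ultimately show ?thesis by simp
qed

text \<open>
  An element \<open>x\<close> is seen as an arrow from \<open>src x\<close> to \<open>tgt x\<close>; arrows compose when source and target
  match, and then the product in \<open>M\<close> is the composition of a groupoid.
\<close>

definition src :: "'a \<Rightarrow> 'a" where "src x = x\<^sup>\<star> \<otimes> x"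

definition tgt :: "'a \<Rightarrow> 'a" where "tgt x = x \<otimes> x\<^sup>\<star>"

lemma src_closed [simp]: "x \<in> carrier M \<Longrightarrow> src x \<in> carrier M"
  and tgt_closed [simp]: "x \<in> carrier M \<Longrightarrow> tgt x \<in> carrier M"
  unfolding src_def tgt_def by auto

lemma src_idem [simp]: "x \<in> carrier M \<Longrightarrow> src x \<otimes> src x = src x"
  and tgt_idem [simp]: "x \<in> carrier M \<Longrightarrow> tgt x \<otimes> tgt x = tgt x"
  and src_sinv [simp]: "x \<in> carrier M \<Longrightarrow> src (x\<^sup>\<star>) = tgt x"
  and tgt_sinv [simp]: "x \<in> carrier M \<Longrightarrow> tgt (x\<^sup>\<star>) = src x"
  and mult_src [simp]: "x \<in> carrier M \<Longrightarrow> x \<otimes> src x = x"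
  and tgt_mult [simp]: "x \<in> carrier M \<Longrightarrow> tgt x \<otimes> x = x"
  and src_mult_sinv: "x \<in> carrier M \<Longrightarrow> src x \<otimes> x\<^sup>\<star> = x\<^sup>\<star>"
  and sinv_mult_tgt: "x \<in> carrier M \<Longrightarrow> x\<^sup>\<star> \<otimes> tgt x = x\<^sup>\<star>"
  unfolding src_def tgt_def by (simp_all add: m_assoc sinv_assoc)

lemma src_tgt_assoc [simp]:
  assumes "x \<in> carrier M" "z \<in> carrier M"
  shows "x \<otimes> (src x \<otimes> z) = x \<otimes> z" "tgt x \<otimes> (x \<otimes> z) = x \<otimes> z"
    and "src x \<otimes> (src x \<otimes> z) = src x \<otimes> z" "tgt x \<otimes> (tgt x \<otimes> z) = tgt x \<otimes> z"
  using assms by (simp_all add: m_assoc[symmetric])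

lemma sinv_mult:
  assumes [simp]: "x \<in> carrier M" "y \<in> carrier M"
  shows "(x \<otimes> y)\<^sup>\<star> = y\<^sup>\<star> \<otimes> x\<^sup>\<star>"
proof (rule sinv_unique)
  have c: "tgt y \<otimes> src x = src x \<otimes> tgt y" by (intro idem_comm) auto
  have "x \<otimes> y \<otimes> (y\<^sup>\<star> \<otimes> x\<^sup>\<star>) \<otimes> (x \<otimes> y) = x \<otimes> (tgt y \<otimes> src x) \<otimes> y"
    unfolding src_def tgt_def by (simp add: m_assoc)
  also have "\<dots> = (x \<otimes> src x) \<otimes> (tgt y \<otimes> y)"
    unfolding c by (simp add: m_assoc)
  finally show "x \<otimes> y \<otimes> (y\<^sup>\<star> \<otimes> x\<^sup>\<star>) \<otimes> (x \<otimes> y) = x \<otimes> y" by simp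
  have "y\<^sup>\<star> \<otimes> x\<^sup>\<star> \<otimes> (x \<otimes> y) \<otimes> (y\<^sup>\<star> \<otimes> x\<^sup>\<star>) = y\<^sup>\<star> \<otimes> (src x \<otimes> tgt y) \<otimes> x\<^sup>\<star>"
    unfolding src_def tgt_def by (simp add: m_assoc)
  also have "\<dots> = (y\<^sup>\<star> \<otimes> tgt y) \<otimes> (src x \<otimes> x\<^sup>\<star>)"
    unfolding c[symmetric] by (simp add: m_assoc)
  finally show "y\<^sup>\<star> \<otimes> x\<^sup>\<star> \<otimes> (x \<otimes> y) \<otimes> (y\<^sup>\<star> \<otimes> x\<^sup>\<star>) = y\<^sup>\<star> \<otimes> x\<^sup>\<star>"
    by (simp add: src_mult_sinv sinv_mult_tgt)
qed simp_all

lemma idem_src_tgt: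
  assumes "e \<in> carrier M" "e \<otimes> e = e"
  shows "src e = e" "tgt e = e"
  using assms by (simp_all add: src_def tgt_def sinv_idem)

lemma tgt_tgt [simp]: "x \<in> carrier M \<Longrightarrow> tgt (tgt x) = tgt x"
  and src_tgt [simp]: "x \<in> carrier M \<Longrightarrow> src (tgt x) = tgt x"
  and tgt_src [simp]: "x \<in> carrier M \<Longrightarrow> tgt (src x) = src x"
  and src_src [simp]: "x \<in> carrier M \<Longrightarrow> src (src x) = src x"
  by (simp_all add: idem_src_tgt)

lemma composable:
  assumes [simp]: "x \<in> carrier M" "y \<in> carrier M" and c: "src x = tgt y"
  shows src_mult: "src (x \<otimes> y) = src y" and tgt_mult_composable: "tgt (x \<otimes> y) = tgt x"
proof -
  have "src (x \<otimes> y) = y\<^sup>\<star> \<otimes> src x \<otimes> y"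
    by (simp add: src_def sinv_mult m_assoc)
  also have "\<dots> = src y" unfolding c by (simp add: sinv_mult_tgt) (simp add: src_def)
  finally show "src (x \<otimes> y) = src y" .
  have "tgt (x \<otimes> y) = x \<otimes> tgt y \<otimes> x\<^sup>\<star>"
    by (simp add: tgt_def sinv_mult m_assoc)
  also have "\<dots> = tgt x" unfolding c[symmetric] by (simp add: tgt_def)
  finally show "tgt (x \<otimes> y) = tgt x" .
qed

lemma cancel_composable:
  assumes [simp]: "x \<in> carrier M" "y \<in> carrier M"
  shows "src x = tgt y \<Longrightarrow> x\<^sup>\<star> \<otimes> (x \<otimes> y) = y"
    and "tgt x = tgt y \<Longrightarrow> x \<otimes> (x\<^sup>\<star> \<otimes> y) = y"
    and "src x = src y \<Longrightarrow> y \<otimes> x\<^sup>\<star> \<otimes> x = y"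
    and "tgt x = src y \<Longrightarrow> y \<otimes> x \<otimes> x\<^sup>\<star> = y"
proof -
  show "x\<^sup>\<star> \<otimes> (x \<otimes> y) = y" if "src x = tgt y"
    using that by (simp add: m_assoc[symmetric] src_def[symmetric])
  show "x \<otimes> (x\<^sup>\<star> \<otimes> y) = y" if "tgt x = tgt y"
    using that by (simp add: m_assoc[symmetric] tgt_def[symmetric])
  show "y \<otimes> x\<^sup>\<star> \<otimes> x = y" if "src x = src y"
    using that by (simp add: m_assoc src_def[symmetric])
  show "y \<otimes> x \<otimes> x\<^sup>\<star> = y" if "tgt x = src y"
    using that by (simp add: m_assoc tgt_def[symmetric])
qed

text \<open>
  The natural partial order.  It amounts to restricting the arrow \<open>y\<close> to a smaller target, or
  equally to a smaller source.
\<close>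

definition natural_le :: "'a \<Rightarrow> 'a \<Rightarrow> bool" (infix \<open>\<preceq>\<close> 50) where
  "x \<preceq> y \<longleftrightarrow> x \<in> carrier M \<and> y \<in> carrier M \<and> x = tgt x \<otimes> y"

lemma natural_le_carrier: "x \<preceq> y \<Longrightarrow> x \<in> carrier M" "x \<preceq> y \<Longrightarrow> y \<in> carrier M"
  unfolding natural_le_def by auto

lemma natural_le_refl [simp]: "x \<in> carrier M \<Longrightarrow> x \<preceq> x"
  unfolding natural_le_def by simp

lemma idem_mult_natural_le:
  assumes [simp]: "e \<in> carrier M" "y \<in> carrier M" and e: "e \<otimes> e = e"
  shows "e \<otimes> y \<preceq> y"
proof -
  have "tgt (e \<otimes> y) = e \<otimes> tgt y \<otimes> e"
    using sinv_idem[OF _ e] by (simp add: tgt_def sinv_mult m_assoc)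
  also have "\<dots> = e \<otimes> (tgt y \<otimes> e)" by (simp add: m_assoc)
  also have "tgt y \<otimes> e = e \<otimes> tgt y" using e by (intro idem_comm) auto
  also have "e \<otimes> (e \<otimes> tgt y) = e \<otimes> tgt y" using e by (simp add: m_assoc[symmetric])
  finally have "tgt (e \<otimes> y) \<otimes> y = e \<otimes> y" by (simp add: m_assoc)
  then show ?thesis unfolding natural_le_def by simp
qed

lemma mult_idem_natural_le:
  assumes [simp]: "e \<in> carrier M" "y \<in> carrier M" and e: "e \<otimes> e = e"
  shows "y \<otimes> e \<preceq> y"
proof -
  have c: "e \<otimes> src y = src y \<otimes> e" using e by (intro idem_comm) auto
  have "y \<otimes> e \<otimes> y\<^sup>\<star> \<otimes> (y \<otimes> e \<otimes> y\<^sup>\<star>) = y \<otimes> (e \<otimes> src y) \<otimes> e \<otimes> y\<^sup>\<star>"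
    by (simp add: src_def m_assoc)
  also have "\<dots> = y \<otimes> e \<otimes> y\<^sup>\<star>" unfolding c using e 
    by (simp add: m_assoc[symmetric]) (simp add: m_assoc)
  finally have "y \<otimes> e \<otimes> y\<^sup>\<star> \<otimes> y \<preceq> y" by (intro idem_mult_natural_le) auto
  moreover have "y \<otimes> e \<otimes> y\<^sup>\<star> \<otimes> y = y \<otimes> (e \<otimes> src y)" by (simp add: src_def m_assoc)
  moreover have "\<dots> = y \<otimes> e" unfolding c by (simp add: m_assoc[symmetric])
  ultimately show ?thesis by simp
qed

lemma natural_le_mult_src:
  assumes "x \<preceq> y"
  shows "x = y \<otimes> src x"
proof -
  have [simp]: "x \<in> carrier M" "y \<in> carrier M" and x: "x = tgt x \<otimes> y"
    using assms unfolding natural_le_def by auto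
  have c: "tgt y \<otimes> tgt x = tgt x \<otimes> tgt y" by (intro idem_comm) auto
  have "x\<^sup>\<star> = y\<^sup>\<star> \<otimes> tgt x"
    using arg_cong[OF x, of sinv] sinv_idem[of "tgt x"] by (simp add: sinv_mult)
  then have "src x = y\<^sup>\<star> \<otimes> tgt x \<otimes> x" by (simp add: src_def)
  then have "y \<otimes> src x = tgt y \<otimes> tgt x \<otimes> y" using x by (simp add: tgt_def[of y] m_assoc)
  also have "\<dots> = tgt x \<otimes> y" unfolding c by (simp add: m_assoc)
  finally show ?thesis using x by simp
qed

lemma natural_le_trans:
  assumes "x \<preceq> y" "y \<preceq> z"
  shows "x \<preceq> z"
proof -
  have [simp]: "x \<in> carrier M" "y \<in> carrier M" "z \<in> carrier M"
    and x: "x = tgt x \<otimes> y" and y: "y = tgt y \<otimes> z"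
    using assms unfolding natural_le_def by auto
  have "x = tgt x \<otimes> tgt y \<otimes> z" using x y by (simp add: m_assoc)
  then show ?thesis
    using idem_mult_natural_le[of "tgt x \<otimes> tgt y" z] idem_mult_idem[of "tgt x" "tgt y"] by simp
qed

lemma natural_le_antisym:
  assumes "x \<preceq> y" "y \<preceq> x"
  shows "x = y"
proof -
  have [simp]: "x \<in> carrier M" "y \<in> carrier M" and x: "x = tgt x \<otimes> y" and y: "y = tgt y \<otimes> x"
    using assms unfolding natural_le_def by auto
  have "y = tgt y \<otimes> tgt x \<otimes> y" using x y by (simp add: m_assoc)
  also have "tgt y \<otimes> tgt x = tgt x \<otimes> tgt y" by (intro idem_comm) auto
  also have "tgt x \<otimes> tgt y \<otimes> y = tgt x \<otimes> y" by (simp add: m_assoc)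
  finally show ?thesis using x by simp
qed

lemma natural_le_eq_tgt: "x \<preceq> y \<Longrightarrow> tgt x = tgt y \<Longrightarrow> x = y"
  unfolding natural_le_def by simp

text \<open>
  Elements below a product factor uniquely into composable elements below the factors, because the
  factorization of \<open>z\<close> can only be \<open>(tgt z \<otimes> s) \<otimes> (t \<otimes> src z)\<close>.  This is what turns the product of \<open>M\<close>
  into the composition of the groupoid.
\<close>

lemma bij_betw_below_mult:
  assumes [simp]: "s \<in> carrier M" "t \<in> carrier M"
  shows "bij_betw (\<lambda>(x, y). x \<otimes> y) {(x, y). x \<preceq> s \<and> y \<preceq> t \<and> src x = tgt y} {z. z \<preceq> s \<otimes> t}"
proof (rule bij_betw_imageI)
  show "inj_on (\<lambda>(x, y). x \<otimes> y) {(x, y). x \<preceq> s \<and> y \<preceq> t \<and> src x = tgt y}"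
  proof (rule inj_onI, clarsimp)
    fix x y x' y'
    assume le: "x \<preceq> s" "y \<preceq> t" "x' \<preceq> s" "y' \<preceq> t"
      and c: "src x = tgt y" "src x' = tgt y'" and eq: "x \<otimes> y = x' \<otimes> y'"
    note [simp] = le[THEN natural_le_carrier(1)]
    have "tgt x = tgt x'" "src y = src y'"
      using src_mult[OF _ _ c(1)] src_mult[OF _ _ c(2)]
        tgt_mult_composable[OF _ _ c(1)] tgt_mult_composable[OF _ _ c(2)] eq by auto
    then show "x = x' \<and> y = y'"
      using le natural_le_mult_src[of y t] natural_le_mult_src[of y' t] unfolding natural_le_def by auto
  qed
  have "x \<otimes> y \<preceq> s \<otimes> t" if le: "x \<preceq> s" "y \<preceq> t" for x y
  proof -
    note [simp] = le[THEN natural_le_carrier(1)]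
    have "x = tgt x \<otimes> s" "y = t \<otimes> src y" using le natural_le_mult_src unfolding natural_le_def by auto
    then have "x \<otimes> y = tgt x \<otimes> s \<otimes> (t \<otimes> src y)" by simp
    then have "x \<otimes> y = tgt x \<otimes> (s \<otimes> t \<otimes> src y)" by (simp add: m_assoc)
    then show ?thesis
      using natural_le_trans[OF idem_mult_natural_le[of "tgt x" "s \<otimes> t \<otimes> src y"] mult_idem_natural_le] by simp
  qed
  moreover have "\<exists>x y. x \<preceq> s \<and> y \<preceq> t \<and> src x = tgt y \<and> z = x \<otimes> y" if z: "z \<preceq> s \<otimes> t" for z
  proof (intro exI conjI)
    have [simp]: "z \<in> carrier M" and z1: "z = tgt z \<otimes> (s \<otimes> t)"
      using z unfolding natural_le_def by auto
    have z2: "z = s \<otimes> t \<otimes> src z" using natural_le_mult_src[OF z] .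
    define x where "x = tgt z \<otimes> s"
    define y where "y = t \<otimes> src z"
    have [simp]: "x \<in> carrier M" "y \<in> carrier M" unfolding x_def y_def by auto
    show "tgt z \<otimes> s \<preceq> s" by (intro idem_mult_natural_le) auto
    show "t \<otimes> src z \<preceq> t" by (intro mult_idem_natural_le) auto
    have "tgt z \<otimes> s \<otimes> (t \<otimes> src z) = (tgt z \<otimes> (s \<otimes> t)) \<otimes> src z" by (simp add: m_assoc)
    then show "z = tgt z \<otimes> s \<otimes> (t \<otimes> src z)" using z1 by simp
    have zx: "z = x \<otimes> t" using z1 unfolding x_def by (simp add: m_assoc)
    have zy: "z = s \<otimes> y" using z2 unfolding y_def by (simp add: m_assoc)
    \<comment> \<open>Each of the commuting idempotents \<open>src x\<close> and \<open>tgt y\<close> is expressed by the other.\<close>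
    have "src x = s\<^sup>\<star> \<otimes> (tgt z \<otimes> tgt z) \<otimes> s"
      unfolding x_def src_def using sinv_idem[of "tgt z"] by (simp add: sinv_mult m_assoc)
    also have "\<dots> = s\<^sup>\<star> \<otimes> tgt z \<otimes> s" by simp
    also have "tgt z = s \<otimes> tgt y \<otimes> s\<^sup>\<star>"
      by (subst zy, unfold tgt_def) (simp add: sinv_mult m_assoc)
    also have "s\<^sup>\<star> \<otimes> (s \<otimes> tgt y \<otimes> s\<^sup>\<star>) \<otimes> s = src s \<otimes> tgt y \<otimes> src s"
      by (simp add: src_def m_assoc)
    also have "\<dots> = src s \<otimes> tgt y"
      using idem_comm[of "tgt y" "src s"] by (simp add: m_assoc)
    finally have x: "src x = src s \<otimes> tgt y" .
    have "tgt y = t \<otimes> (src z \<otimes> src z) \<otimes> t\<^sup>\<star>"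
      unfolding y_def tgt_def using sinv_idem[of "src z"] by (simp add: sinv_mult m_assoc)
    also have "\<dots> = t \<otimes> src z \<otimes> t\<^sup>\<star>" by simp
    also have "src z = t\<^sup>\<star> \<otimes> src x \<otimes> t"
      by (subst zx, unfold src_def) (simp add: sinv_mult m_assoc)
    also have "t \<otimes> (t\<^sup>\<star> \<otimes> src x \<otimes> t) \<otimes> t\<^sup>\<star> = tgt t \<otimes> src x \<otimes> tgt t"
      by (simp add: tgt_def m_assoc)
    also have "\<dots> = tgt t \<otimes> src x"
      using idem_comm[of "src x" "tgt t"] by (simp add: m_assoc)
    finally have y: "tgt y = tgt t \<otimes> src x" .
    have ty: "tgt t \<otimes> tgt y = tgt y"
      by (subst (1 2) y) (simp add: m_assoc[symmetric])
    have "tgt y = tgt t \<otimes> src s \<otimes> tgt y" using x y by (simp add: m_assoc)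
    also have "tgt t \<otimes> src s = src s \<otimes> tgt t" by (intro idem_comm) auto
    also have "src s \<otimes> tgt t \<otimes> tgt y = src s \<otimes> (tgt t \<otimes> tgt y)" by (simp add: m_assoc)
    also have "\<dots> = src x" using ty x by simp
    finally show "src (tgt z \<otimes> s) = tgt (t \<otimes> src z)" unfolding x_def y_def by simp
  qed
  ultimately show "(\<lambda>(x, y). x \<otimes> y) ` {(x, y). x \<preceq> s \<and> y \<preceq> t \<and> src x = tgt y} = {z. z \<preceq> s \<otimes> t}"
    by (fastforce simp: image_iff)
qed

text \<open>
  The set of all arrows parallel to \<open>a\<close>; below it turns out to be Green's H-class of \<open>a\<close>.
\<close>

definition hclass :: "'a \<Rightarrow> 'a set" where
  "hclass a = {x \<in> carrier M. src x = src a \<and> tgt x = tgt a}"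

lemma hclass_self: "a \<in> carrier M \<Longrightarrow> a \<in> hclass a"
  unfolding hclass_def by simp

lemma hclass_carrier: "hclass a \<subseteq> carrier M"
  unfolding hclass_def by blast

lemma bij_betw_hclass_mult_left:
  assumes [simp]: "a \<in> carrier M" "t \<in> carrier M" and c: "src t = tgt a"
  shows "bij_betw (\<lambda>x. t \<otimes> x) (hclass a) (hclass (t \<otimes> a))"
proof (rule bij_betw_byWitness[where f' = "\<lambda>x. t\<^sup>\<star> \<otimes> x"])
  show "\<forall>x\<in>hclass a. t\<^sup>\<star> \<otimes> (t \<otimes> x) = x"
    unfolding hclass_def using c by (auto intro!: cancel_composable)
  show "\<forall>x\<in>hclass (t \<otimes> a). t \<otimes> (t\<^sup>\<star> \<otimes> x) = x"
    unfolding hclass_def using c composable[of t a] by (auto intro!: cancel_composable)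
  show "(\<lambda>x. t \<otimes> x) ` hclass a \<subseteq> hclass (t \<otimes> a)"
    unfolding hclass_def using c by (auto simp: composable)
  show "(\<lambda>x. t\<^sup>\<star> \<otimes> x) ` hclass (t \<otimes> a) \<subseteq> hclass a"
    unfolding hclass_def using c composable[of t a] by (auto simp: composable)
qed

lemma bij_betw_hclass_mult_right:
  assumes [simp]: "a \<in> carrier M" "t \<in> carrier M" and c: "tgt t = src a"
  shows "bij_betw (\<lambda>x. x \<otimes> t) (hclass a) (hclass (a \<otimes> t))"
proof (rule bij_betw_byWitness[where f' = "\<lambda>x. x \<otimes> t\<^sup>\<star>"])
  show "\<forall>x\<in>hclass a. x \<otimes> t \<otimes> t\<^sup>\<star> = x"
    unfolding hclass_def using c by (auto intro!: cancel_composable)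
  show "\<forall>x\<in>hclass (a \<otimes> t). x \<otimes> t\<^sup>\<star> \<otimes> t = x"
    unfolding hclass_def using c composable[of a t] by (auto intro!: cancel_composable)
  show "(\<lambda>x. x \<otimes> t) ` hclass a \<subseteq> hclass (a \<otimes> t)"
    unfolding hclass_def using c by (auto simp: composable)
  show "(\<lambda>x. x \<otimes> t\<^sup>\<star>) ` hclass (a \<otimes> t) \<subseteq> hclass a"
    unfolding hclass_def using c composable[of a t] by (auto simp: composable)
qed

lemma card_hclass_mult_left:
  "a \<in> carrier M \<Longrightarrow> t \<in> carrier M \<Longrightarrow> src t = tgt a \<Longrightarrow> card (hclass (t \<otimes> a)) = card (hclass a)"
  by (rule bij_betw_same_card[OF bij_betw_hclass_mult_left, symmetric])

lemma card_hclass_mult_right: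
  "a \<in> carrier M \<Longrightarrow> t \<in> carrier M \<Longrightarrow> tgt t = src a \<Longrightarrow> card (hclass (a \<otimes> t)) = card (hclass a)"
  by (rule bij_betw_same_card[OF bij_betw_hclass_mult_right, symmetric])

lemma card_hclass_src:
  assumes "a \<in> carrier M" "b \<in> carrier M" "src a = src b"
  shows "card (hclass a) = card (hclass b)"
proof -
  have "card (hclass (b \<otimes> a\<^sup>\<star> \<otimes> a)) = card (hclass a)"
    using assms composable[of b "a\<^sup>\<star>"] by (intro card_hclass_mult_left) auto
  then show ?thesis using cancel_composable(3)[of a b] assms by simp
qed

lemma card_hclass_tgt:
  assumes "a \<in> carrier M" "b \<in> carrier M" "tgt a = tgt b"
  shows "card (hclass a) = card (hclass b)"
proof -
  have "card (hclass (a \<otimes> (a\<^sup>\<star> \<otimes> b))) = card (hclass a)"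
    using assms composable[of "a\<^sup>\<star>" b] by (intro card_hclass_mult_right) auto
  then show ?thesis using cancel_composable(2)[of a b] assms by simp
qed

lemma green_L_iff: "(x, y) \<in> green_L M \<longleftrightarrow> x \<in> carrier M \<and> y \<in> carrier M \<and> src x = src y"
proof -
  have le: "src u \<otimes> src v = src u" if uv: "u \<in> carrier M" "v \<in> carrier M" "carrier M #> u \<subseteq> carrier M #> v" for u v
  proof -
    have "u \<in> carrier M #> u" using uv unfolding r_coset_def by (auto intro!: bexI[of _ \<one>])
    then obtain m where m: "m \<in> carrier M" "u = m \<otimes> v" using uv unfolding r_coset_def by auto
    then have "u \<otimes> src v = u" using uv by (simp add: m_assoc)
    then show ?thesis using uv unfolding src_def[of u] by (simp add: m_assoc)
  qed
  have ge: "carrier M #> u \<subseteq> carrier M #> v" if uv: "u \<in> carrier M" "v \<in> carrier M" "src u = src v" for u v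
  proof -
    have "m \<otimes> u = (m \<otimes> u \<otimes> v\<^sup>\<star>) \<otimes> v" if "m \<in> carrier M" for m
      using uv that cancel_composable(3)[of v u] by (simp add: m_assoc)
    then show ?thesis using uv unfolding r_coset_def by fastforce
  qed
  have "src x = src y" if "x \<in> carrier M" "y \<in> carrier M" "carrier M #> x = carrier M #> y"
    using le[of x y] le[of y x] idem_comm[of "src x" "src y"] that by simp
  then show ?thesis using ge[of x y] ge[of y x] unfolding green_L_def by auto
qed

lemma green_R_iff: "(x, y) \<in> green_R M \<longleftrightarrow> x \<in> carrier M \<and> y \<in> carrier M \<and> tgt x = tgt y"
proof -
  have le: "tgt v \<otimes> tgt u = tgt u" if uv: "u \<in> carrier M" "v \<in> carrier M" "u <# carrier M \<subseteq> v <# carrier M" for u v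
  proof -
    have "u \<in> u <# carrier M" using uv unfolding l_coset_def by (auto intro!: bexI[of _ \<one>])
    then obtain m where m: "m \<in> carrier M" "u = v \<otimes> m" using uv unfolding l_coset_def by auto
    then have "tgt v \<otimes> u = u" using uv by (simp add: m_assoc[symmetric])
    then show ?thesis using uv unfolding tgt_def[of u] by (simp add: m_assoc[symmetric])
  qed
  have ge: "u <# carrier M \<subseteq> v <# carrier M" if uv: "u \<in> carrier M" "v \<in> carrier M" "tgt u = tgt v" for u v
  proof -
    have "u \<otimes> m = v \<otimes> (v\<^sup>\<star> \<otimes> u \<otimes> m)" if "m \<in> carrier M" for m
      using uv that cancel_composable(2)[of v u] by (simp add: m_assoc[symmetric])
    then show ?thesis using uv unfolding l_coset_def by fastforce
  qed
  have "tgt x = tgt y" if "x \<in> carrier M" "y \<in> carrier M" "x <# carrier M = y <# carrier M"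
    using le[of x y] le[of y x] idem_comm[of "tgt x" "tgt y"] that by simp
  then show ?thesis using ge[of x y] ge[of y x] unfolding green_R_def by auto
qed

lemma H_classes_eq: "H_classes M = hclass ` carrier M"
proof -
  have "green_H M `` {a} = hclass a" if "a \<in> carrier M" for a
    using that unfolding green_H_def hclass_def by (auto simp: green_L_iff green_R_iff)
  then show ?thesis unfolding H_classes_def quotient_def by auto
qed

lemma hclass_subset_D_class: "a \<in> carrier M \<Longrightarrow> hclass a \<subseteq> green_D M `` {a}"
  unfolding hclass_def green_D_def relcomp_unfold by (auto simp: green_L_iff green_R_iff)

lemma card_hclass_D:
  assumes "(a, b) \<in> green_D M"
  shows "card (hclass a) = card (hclass b)"
proof -
  obtain c where "(a, c) \<in> green_L M" "(c, b) \<in> green_R M"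
    using assms unfolding green_D_def by blast
  then show ?thesis
    using card_hclass_src[of a c] card_hclass_tgt[of c b] by (simp add: green_L_iff green_R_iff)
qed

text \<open>
  All H-classes inside a D-class have the same number of elements, so for counting it does not
  matter at which of them the group is formed.
\<close>

lemma schutzenberger_group_hclass:
  assumes a: "a \<in> carrier M"
  obtains b where "b \<in> carrier M" "card (hclass b) = card (hclass a)"
    "schutzenberger_group M (green_D M `` {a}) = schutzenberger_of M (hclass b)"
proof -
  define H where "H = (SOME H. H \<in> H_classes M \<and> H \<subseteq> green_D M `` {a})"
  have "H \<in> H_classes M \<and> H \<subseteq> green_D M `` {a}"
    unfolding H_def using a hclass_subset_D_class[OF a]
    by (intro someI[of "\<lambda>H. H \<in> H_classes M \<and> H \<subseteq> green_D M `` {a}" "hclass a"])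
      (auto simp: H_classes_eq)
  then obtain b where b: "b \<in> carrier M" "H = hclass b" "hclass b \<subseteq> green_D M `` {a}"
    unfolding H_classes_eq by blast
  then have "(a, b) \<in> green_D M" using hclass_self by blast
  then have "card (hclass b) = card (hclass a)" using card_hclass_D by simp
  moreover have "schutzenberger_group M (green_D M `` {a}) = schutzenberger_of M (hclass b)"
    unfolding schutzenberger_group_def H_def[symmetric] b(2) ..
  ultimately show ?thesis using that b(1) by blast
qed

lemma hclass_heap:
  assumes "x \<in> hclass a" "y \<in> hclass a" "z \<in> hclass a"
  shows "x \<otimes> (y\<^sup>\<star> \<otimes> z) \<in> hclass a"
  using assms composable[of "y\<^sup>\<star>" z] composable[of x "y\<^sup>\<star> \<otimes> z"] unfolding hclass_def by auto

text \<open>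
  A right translation of the H-class of \<open>a\<close> is determined by the image \<open>b\<close> of \<open>a\<close>: every \<open>x\<close> in the
  class is \<open>x \<otimes> a\<^sup>\<star> \<otimes> a\<close>, so it is mapped to \<open>x \<otimes> (a\<^sup>\<star> \<otimes> b)\<close>.
\<close>

lemma right_transl_hclass:
  assumes a: "a \<in> carrier M"
  shows "right_transl M (hclass a) ` RT M (hclass a)
    = (\<lambda>b. right_transl M (hclass a) (a\<^sup>\<star> \<otimes> b)) ` hclass a"
proof (intro equalityI subsetI)
  fix f assume "f \<in> right_transl M (hclass a) ` RT M (hclass a)"
  then obtain m where f: "f = right_transl M (hclass a) m" and m: "m \<in> RT M (hclass a)" by blast
  have mc: "m \<in> carrier M" and b: "a \<otimes> m \<in> hclass a"
    using m hclass_self[OF a] unfolding RT_def r_coset_def by auto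
  have "x \<otimes> m = x \<otimes> (a\<^sup>\<star> \<otimes> (a \<otimes> m))" if "x \<in> hclass a" for x
  proof -
    have "x \<in> carrier M" "x \<otimes> a\<^sup>\<star> \<otimes> a = x"
      using that a cancel_composable(3)[of a x] unfolding hclass_def by auto
    then show ?thesis using a mc by (simp add: m_assoc[symmetric])
  qed
  then have "f = right_transl M (hclass a) (a\<^sup>\<star> \<otimes> (a \<otimes> m))"
    unfolding f right_transl_def by (auto intro!: restrict_ext)
  then show "f \<in> (\<lambda>b. right_transl M (hclass a) (a\<^sup>\<star> \<otimes> b)) ` hclass a" using b by blast
next
  fix f assume "f \<in> (\<lambda>b. right_transl M (hclass a) (a\<^sup>\<star> \<otimes> b)) ` hclass a"
  then obtain b where f: "f = right_transl M (hclass a) (a\<^sup>\<star> \<otimes> b)" and b: "b \<in> hclass a" by blast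
  have "a\<^sup>\<star> \<otimes> b \<in> RT M (hclass a)"
    unfolding RT_def r_coset_def using a subsetD[OF hclass_carrier b] hclass_heap[OF _ hclass_self[OF a] b] by auto
  then show "f \<in> right_transl M (hclass a) ` RT M (hclass a)" using f by blast
qed

lemma card_schutzenberger_of:
  assumes a: "a \<in> carrier M"
  shows "card (carrier (schutzenberger_of M (hclass a))) = card (hclass a)"
proof -
  have "inj_on (\<lambda>b. right_transl M (hclass a) (a\<^sup>\<star> \<otimes> b)) (hclass a)"
  proof (rule inj_onI)
    fix b c assume b: "b \<in> hclass a" and c: "c \<in> hclass a"
      and eq: "right_transl M (hclass a) (a\<^sup>\<star> \<otimes> b) = right_transl M (hclass a) (a\<^sup>\<star> \<otimes> c)"
    have "a \<otimes> (a\<^sup>\<star> \<otimes> b) = a \<otimes> (a\<^sup>\<star> \<otimes> c)"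
      using fun_cong[OF eq, of a] hclass_self[OF a] unfolding right_transl_def by simp
    moreover have "a \<otimes> (a\<^sup>\<star> \<otimes> b) = b" "a \<otimes> (a\<^sup>\<star> \<otimes> c) = c"
      using a b c unfolding hclass_def by (auto intro!: cancel_composable)
    ultimately show "b = c" by simp
  qed
  then show ?thesis
    unfolding schutzenberger_of_def partial_object.simps right_transl_hclass[OF a] by (rule card_image)
qed

lemma group_schutzenberger_of:
  assumes a: "a \<in> carrier M"
  shows "group (schutzenberger_of M (hclass a))"
proof -
  let ?H = "hclass a" and ?G = "schutzenberger_of M (hclass a)"
  have car: "carrier ?G = right_transl M ?H ` RT M ?H" unfolding schutzenberger_of_def by simp
  have RT: "m \<in> carrier M" "x \<in> ?H \<Longrightarrow> x \<otimes> m \<in> ?H" if "m \<in> RT M ?H" for m x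
    using that unfolding RT_def r_coset_def by auto
  have RTI: "m \<in> RT M ?H" if "m \<in> carrier M" "\<And>x. x \<in> ?H \<Longrightarrow> x \<otimes> m \<in> ?H" for m
    using that unfolding RT_def r_coset_def by auto
  have one: "\<one>\<^bsub>?G\<^esub> = right_transl M ?H \<one>"
    unfolding schutzenberger_of_def right_transl_def using hclass_carrier[of a]
    by (auto intro!: restrict_ext)
  have one': "\<one> \<in> RT M ?H" using hclass_carrier[of a] by (intro RTI) auto
  have mult: "right_transl M ?H m \<otimes>\<^bsub>?G\<^esub> right_transl M ?H n = right_transl M ?H (m \<otimes> n)"
    if "m \<in> RT M ?H" "n \<in> RT M ?H" for m n
    unfolding schutzenberger_of_def right_transl_def compose_def
    using RT[OF that(1)] RT(1)[OF that(2)] hclass_carrier[of a] 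
    by (auto intro!: restrict_ext simp: m_assoc)
  have mult': "m \<otimes> n \<in> RT M ?H" if "m \<in> RT M ?H" "n \<in> RT M ?H" for m n
    using RT[OF that(1)] RT[OF that(2)] hclass_carrier[of a]
    by (intro RTI) (auto simp: m_assoc[symmetric])
  show ?thesis
  proof (rule groupI)
    fix f assume "f \<in> carrier ?G"
    then obtain b where b: "b \<in> ?H" "f = right_transl M ?H (a\<^sup>\<star> \<otimes> b)"
      unfolding car right_transl_hclass[OF a] by blast
    have bc: "b \<in> carrier M" using b hclass_carrier by blast
    have m: "a\<^sup>\<star> \<otimes> b \<in> RT M ?H" "b\<^sup>\<star> \<otimes> a \<in> RT M ?H"
      using a bc hclass_heap[OF _ hclass_self[OF a] b(1)] hclass_heap[OF _ b(1) hclass_self[OF a]]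
      by (auto intro!: RTI)
    have "x \<otimes> (b\<^sup>\<star> \<otimes> a \<otimes> (a\<^sup>\<star> \<otimes> b)) = x" if "x \<in> ?H" for x
    proof -
      have x: "x \<in> carrier M" "src x = src b" "src b = src a" "tgt b = tgt a"
        using that b unfolding hclass_def by auto
      have "x \<otimes> (b\<^sup>\<star> \<otimes> a \<otimes> (a\<^sup>\<star> \<otimes> b)) = x \<otimes> (b\<^sup>\<star> \<otimes> (a \<otimes> (a\<^sup>\<star> \<otimes> b)))"
        using a bc x by (simp add: m_assoc)
      also have "\<dots> = x \<otimes> b\<^sup>\<star> \<otimes> b"
        using a bc x cancel_composable(2)[of a b] by (simp add: m_assoc)
      finally show ?thesis using bc x cancel_composable(3)[of b x] by simp
    qed
    then have "right_transl M ?H (b\<^sup>\<star> \<otimes> a \<otimes> (a\<^sup>\<star> \<otimes> b)) = \<one>\<^bsub>?G\<^esub>"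
      unfolding one right_transl_def using hclass_carrier[of a] by (auto intro!: restrict_ext)
    then show "\<exists>g\<in>carrier ?G. g \<otimes>\<^bsub>?G\<^esub> f = \<one>\<^bsub>?G\<^esub>"
      unfolding b(2) car using m mult by auto
  next
    fix f assume "f \<in> carrier ?G"
    then show "\<one>\<^bsub>?G\<^esub> \<otimes>\<^bsub>?G\<^esub> f = f"
      unfolding car one using one' mult RT(1) by auto
  next
    fix f g h assume "f \<in> carrier ?G" "g \<in> carrier ?G" "h \<in> carrier ?G"
    then obtain l m n where *: "l \<in> RT M ?H" "m \<in> RT M ?H" "n \<in> RT M ?H"
      "f = right_transl M ?H l" "g = right_transl M ?H m" "h = right_transl M ?H n"
      unfolding car by blast
    show "f \<otimes>\<^bsub>?G\<^esub> g \<otimes>\<^bsub>?G\<^esub> h = f \<otimes>\<^bsub>?G\<^esub> (g \<otimes>\<^bsub>?G\<^esub> h)"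
      unfolding *(4-6) using *(1-3) RT(1) mult mult' by (simp add: m_assoc)
  next
    show "\<one>\<^bsub>?G\<^esub> \<in> carrier ?G" unfolding car one using one' by blast
    show "f \<otimes>\<^bsub>?G\<^esub> g \<in> carrier ?G" if "f \<in> carrier ?G" "g \<in> carrier ?G" for f g
      using that mult mult' unfolding car by auto
  qed
qed

lemma below_one:
  "{e. e \<preceq> \<one>} = {e \<in> carrier M. tgt e = e}"
  unfolding natural_le_def by auto

text \<open>
  The arrows that start at the chosen object of their connected component.  The choice is a function
  of the set of all objects of the component, so it is constant on each component.
\<close>

definition transversal :: "'a set" where
  "transversal = {s \<in> carrier M. src s = (SOME f. \<exists>t\<in>carrier M. tgt t = tgt s \<and> src t = f)}"

lemma transversal_carrier: "transversal \<subseteq> carrier M"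
  unfolding transversal_def by blast

lemma transversal_mult:
  assumes "s \<in> carrier M" "t \<in> carrier M" "src t = tgt s"
  shows "t \<otimes> s \<in> transversal \<longleftrightarrow> s \<in> transversal"
proof -
  have "(\<exists>u\<in>carrier M. tgt u = tgt t \<and> src u = f) \<longleftrightarrow> (\<exists>u\<in>carrier M. tgt u = tgt s \<and> src u = f)" for f
  proof
    assume "\<exists>u\<in>carrier M. tgt u = tgt t \<and> src u = f"
    then obtain u where "u \<in> carrier M" "tgt u = tgt t" "src u = f" by blast
    then show "\<exists>u\<in>carrier M. tgt u = tgt s \<and> src u = f"
      using assms composable[of "t\<^sup>\<star>" u] by (intro bexI[of _ "t\<^sup>\<star> \<otimes> u"]) auto
  next
    assume "\<exists>u\<in>carrier M. tgt u = tgt s \<and> src u = f"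
    then obtain u where "u \<in> carrier M" "tgt u = tgt s" "src u = f" by blast
    then show "\<exists>u\<in>carrier M. tgt u = tgt t \<and> src u = f"
      using assms composable[of t u] by (intro bexI[of _ "t \<otimes> u"]) auto
  qed
  then show ?thesis
    using assms composable[of t s] unfolding transversal_def by simp
qed

lemma transversal_fibre:
  assumes e: "e \<in> carrier M" "tgt e = e"
  obtains u where "u \<in> carrier M" "tgt u = e" "{s \<in> transversal. tgt s = e} = hclass u"
proof -
  define P where "P f \<longleftrightarrow> (\<exists>t\<in>carrier M. tgt t = e \<and> src t = f)" for f
  have "P (src e)" unfolding P_def using e by blast
  then have "P (SOME f. P f)" by (rule someI)
  then obtain u where u: "u \<in> carrier M" "tgt u = e" "src u = (SOME f. P f)"
    unfolding P_def by blast
  have "{s \<in> transversal. tgt s = e} = hclass u"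
    using u unfolding transversal_def hclass_def P_def by auto
  then show ?thesis using that u by blast
qed

end

lemma (in group) inverse_monoid_group: "inverse_monoid G"
proof
  show "inverse_semigroup G"
    unfolding inverse_semigroup_def
  proof (intro conjI ballI)
    fix a assume a: "a \<in> carrier G"
    show "\<exists>!b. b \<in> carrier G \<and> a \<otimes> b \<otimes> a = a \<and> b \<otimes> a \<otimes> b = b"
    proof (rule ex1I[of _ "inv a"])
      fix b assume b: "b \<in> carrier G \<and> a \<otimes> b \<otimes> a = a \<and> b \<otimes> a \<otimes> b = b"
      then have "a \<otimes> b = \<one>" using a r_cancel_one'[of a "a \<otimes> b"] by simp
      then show "b = inv a" using a b inv_equality[of a b] by auto
    qed (use a in auto)
  qed (auto simp: m_assoc)
qed

lemma (in group) hclass_group: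
  assumes "a \<in> carrier G"
  shows "inverse_monoid.hclass G a = carrier G"
proof -
  interpret inverse_monoid G by (rule inverse_monoid_group)
  have "sinv x = inv x" if "x \<in> carrier G" for x
    using that by (intro sinv_unique) auto
  then have "src x = \<one>" "tgt x = \<one>" if "x \<in> carrier G" for x
    using that unfolding src_def tgt_def by auto
  then show ?thesis using assms unfolding hclass_def by auto
qed

section \<open>Algebras of finite monoids over a field\<close>

locale finite_monoid_algebra = K: field K + M: monoid M
  for K :: "('k, 'r) ring_scheme" and M :: "('m, 's) monoid_scheme" +
  assumes finite_M [simp]: "finite (carrier M)"
begin

abbreviation KM :: "('k, 'm \<Rightarrow> 'k) module" where "KM \<equiv> monoid_algebra K M"

lemma KM_simps:
  "carrier KM = carrier M \<rightarrow>\<^sub>E carrier K"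
  "\<zero>\<^bsub>KM\<^esub> = (\<lambda>x\<in>carrier M. \<zero>\<^bsub>K\<^esub>)"
  "\<one>\<^bsub>KM\<^esub> = (\<lambda>x\<in>carrier M. if x = \<one>\<^bsub>M\<^esub> then \<one>\<^bsub>K\<^esub> else \<zero>\<^bsub>K\<^esub>)"
  "f \<oplus>\<^bsub>KM\<^esub> g = (\<lambda>x\<in>carrier M. f x \<oplus>\<^bsub>K\<^esub> g x)"
  "c \<odot>\<^bsub>KM\<^esub> f = (\<lambda>x\<in>carrier M. c \<otimes>\<^bsub>K\<^esub> f x)"
  unfolding monoid_algebra_def by simp_all

lemma add_KM_apply:
    "x \<in> carrier M \<Longrightarrow> (f \<oplus>\<^bsub>KM\<^esub> g) x = f x \<oplus>\<^bsub>K\<^esub> g x"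
  and smult_KM_apply: "x \<in> carrier M \<Longrightarrow> (c \<odot>\<^bsub>KM\<^esub> f) x = c \<otimes>\<^bsub>K\<^esub> f x"
  by (simp_all add: KM_simps)

definition factorizations :: "'m \<Rightarrow> ('m \<times> 'm) set" where
  "factorizations x = {(y, z) \<in> carrier M \<times> carrier M. y \<otimes>\<^bsub>M\<^esub> z = x}"

lemma mult_KM:
  "f \<otimes>\<^bsub>KM\<^esub> g =
    (\<lambda>x\<in>carrier M. \<Oplus>\<^bsub>K\<^esub>p\<in>factorizations x. f (fst p) \<otimes>\<^bsub>K\<^esub> g (snd p))"
  unfolding monoid_algebra_def factorizations_def by simp

lemma finite_factorizations: "finite (factorizations x)"
  by (rule finite_subset[of _ "carrier M \<times> carrier M"]) (auto simp: factorizations_def)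

lemma factorizations_closed:
  "p \<in> factorizations x \<Longrightarrow> fst p \<in> carrier M" "p \<in> factorizations x \<Longrightarrow> snd p \<in> carrier M"
  unfolding factorizations_def by auto

lemma KM_apply [simp]: "f \<in> carrier KM \<Longrightarrow> x \<in> carrier M \<Longrightarrow> f x \<in> carrier K"
  unfolding KM_simps by auto

lemma factorizations_iff:
  "(y, z) \<in> factorizations x \<longleftrightarrow> y \<in> carrier M \<and> z \<in> carrier M \<and> y \<otimes>\<^bsub>M\<^esub> z = x"
  unfolding factorizations_def by auto

lemma convolution_summand_closed:
  assumes "f \<in> carrier KM" "g \<in> carrier KM"
  shows "(\<lambda>p. f (fst p) \<otimes>\<^bsub>K\<^esub> g (snd p)) \<in> factorizations x \<rightarrow> carrier K"
  using assms by (intro funcsetI) (simp add: factorizations_closed)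

lemma KM_eqI:
  assumes "f \<in> carrier KM" "g \<in> carrier KM" "\<And>x. x \<in> carrier M \<Longrightarrow> f x = g x"
  shows "f = g"
  using assms unfolding KM_simps by (intro PiE_ext) auto

lemma KM_closed:
  "f \<in> carrier KM \<Longrightarrow> g \<in> carrier KM \<Longrightarrow> f \<oplus>\<^bsub>KM\<^esub> g \<in> carrier KM"
  "\<zero>\<^bsub>KM\<^esub> \<in> carrier KM" "\<one>\<^bsub>KM\<^esub> \<in> carrier KM"
  "c \<in> carrier K \<Longrightarrow> f \<in> carrier KM \<Longrightarrow> c \<odot>\<^bsub>KM\<^esub> f \<in> carrier KM"
  unfolding KM_simps by auto

lemma mult_KM_closed:
  "f \<in> carrier KM \<Longrightarrow> g \<in> carrier KM \<Longrightarrow> f \<otimes>\<^bsub>KM\<^esub> g \<in> carrier KM"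
  unfolding mult_KM KM_simps
  by (auto intro!: K.finsum_closed K.m_closed dest: factorizations_closed)

lemma abelian_group_KM: "abelian_group KM"
proof (rule abelian_groupI)
  fix f assume f: "f \<in> carrier KM"
  show "\<exists>g\<in>carrier KM. g \<oplus>\<^bsub>KM\<^esub> f = \<zero>\<^bsub>KM\<^esub>"
    using f by (intro bexI[of _ "\<lambda>x\<in>carrier M. \<ominus>\<^bsub>K\<^esub> f x"])
      (auto simp: KM_simps K.l_neg PiE_iff intro!: restrict_ext)
next
  fix f g h assume "f \<in> carrier KM" "g \<in> carrier KM" "h \<in> carrier KM"
  then show "f \<oplus>\<^bsub>KM\<^esub> g \<oplus>\<^bsub>KM\<^esub> h = f \<oplus>\<^bsub>KM\<^esub> (g \<oplus>\<^bsub>KM\<^esub> h)" "f \<oplus>\<^bsub>KM\<^esub> g = g \<oplus>\<^bsub>KM\<^esub> f"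
    by (auto simp: KM_simps(4) K.a_assoc intro!: restrict_ext K.a_comm)
next
  fix f assume "f \<in> carrier KM"
  then show "\<zero>\<^bsub>KM\<^esub> \<oplus>\<^bsub>KM\<^esub> f = f"
    by (intro KM_eqI KM_closed) (auto simp: KM_simps(2,4))
qed (auto intro: KM_closed)

lemma mult_KM_distrib:
  assumes f: "f \<in> carrier KM" and g: "g \<in> carrier KM" and h: "h \<in> carrier KM"
  shows "(f \<oplus>\<^bsub>KM\<^esub> g) \<otimes>\<^bsub>KM\<^esub> h = f \<otimes>\<^bsub>KM\<^esub> h \<oplus>\<^bsub>KM\<^esub> g \<otimes>\<^bsub>KM\<^esub> h"
    and "h \<otimes>\<^bsub>KM\<^esub> (f \<oplus>\<^bsub>KM\<^esub> g) = h \<otimes>\<^bsub>KM\<^esub> f \<oplus>\<^bsub>KM\<^esub> h \<otimes>\<^bsub>KM\<^esub> g"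
proof -
  note c = convolution_summand_closed
  show "(f \<oplus>\<^bsub>KM\<^esub> g) \<otimes>\<^bsub>KM\<^esub> h = f \<otimes>\<^bsub>KM\<^esub> h \<oplus>\<^bsub>KM\<^esub> g \<otimes>\<^bsub>KM\<^esub> h"
  proof (intro KM_eqI KM_closed mult_KM_closed f g h)
    fix x assume x: "x \<in> carrier M"
    have "((f \<oplus>\<^bsub>KM\<^esub> g) \<otimes>\<^bsub>KM\<^esub> h) x
      = (\<Oplus>\<^bsub>K\<^esub>p\<in>factorizations x. (f \<oplus>\<^bsub>KM\<^esub> g) (fst p) \<otimes>\<^bsub>K\<^esub> h (snd p))"
      using x by (simp add: mult_KM)
    also have "\<dots> = (\<Oplus>\<^bsub>K\<^esub>p\<in>factorizations x. f (fst p) \<otimes>\<^bsub>K\<^esub> h (snd p) \<oplus>\<^bsub>K\<^esub> g (fst p) \<otimes>\<^bsub>K\<^esub> h (snd p))"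
      by (rule K.finsum_cong'[OF refl])
        (use f g h in \<open>auto simp: KM_simps(4) K.l_distr factorizations_iff\<close>)
    also have "\<dots> = (f \<otimes>\<^bsub>KM\<^esub> h \<oplus>\<^bsub>KM\<^esub> g \<otimes>\<^bsub>KM\<^esub> h) x"
      using x K.finsum_addf[OF c[OF f h, of x] c[OF g h, of x]] by (simp add: mult_KM KM_simps(4))
    finally show "((f \<oplus>\<^bsub>KM\<^esub> g) \<otimes>\<^bsub>KM\<^esub> h) x = (f \<otimes>\<^bsub>KM\<^esub> h \<oplus>\<^bsub>KM\<^esub> g \<otimes>\<^bsub>KM\<^esub> h) x" .
  qed
  show "h \<otimes>\<^bsub>KM\<^esub> (f \<oplus>\<^bsub>KM\<^esub> g) = h \<otimes>\<^bsub>KM\<^esub> f \<oplus>\<^bsub>KM\<^esub> h \<otimes>\<^bsub>KM\<^esub> g"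
  proof (intro KM_eqI KM_closed mult_KM_closed f g h)
    fix x assume x: "x \<in> carrier M"
    have "(h \<otimes>\<^bsub>KM\<^esub> (f \<oplus>\<^bsub>KM\<^esub> g)) x
      = (\<Oplus>\<^bsub>K\<^esub>p\<in>factorizations x. h (fst p) \<otimes>\<^bsub>K\<^esub> (f \<oplus>\<^bsub>KM\<^esub> g) (snd p))"
      using x by (simp add: mult_KM)
    also have "\<dots> = (\<Oplus>\<^bsub>K\<^esub>p\<in>factorizations x. h (fst p) \<otimes>\<^bsub>K\<^esub> f (snd p) \<oplus>\<^bsub>K\<^esub> h (fst p) \<otimes>\<^bsub>K\<^esub> g (snd p))"
      by (rule K.finsum_cong'[OF refl])
        (use f g h in \<open>auto simp: KM_simps(4) K.r_distr factorizations_iff\<close>)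
    also have "\<dots> = (h \<otimes>\<^bsub>KM\<^esub> f \<oplus>\<^bsub>KM\<^esub> h \<otimes>\<^bsub>KM\<^esub> g) x"
      using x K.finsum_addf[OF c[OF h f, of x] c[OF h g, of x]] by (simp add: mult_KM KM_simps(4))
    finally show "(h \<otimes>\<^bsub>KM\<^esub> (f \<oplus>\<^bsub>KM\<^esub> g)) x = (h \<otimes>\<^bsub>KM\<^esub> f \<oplus>\<^bsub>KM\<^esub> h \<otimes>\<^bsub>KM\<^esub> g) x" .
  qed
qed

definition monomial :: "'k \<Rightarrow> 'm \<Rightarrow> 'm \<Rightarrow> 'k" where
  "monomial c s = (\<lambda>x\<in>carrier M. if x = s then c else \<zero>\<^bsub>K\<^esub>)"

lemma monomial_closed [simp]: "c \<in> carrier K \<Longrightarrow> monomial c s \<in> carrier KM"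
  unfolding monomial_def KM_simps by auto

lemma mult_monomial:
  assumes c: "c \<in> carrier K" and d: "d \<in> carrier K" and s: "s \<in> carrier M" and t: "t \<in> carrier M"
  shows "monomial c s \<otimes>\<^bsub>KM\<^esub> monomial d t = monomial (c \<otimes>\<^bsub>K\<^esub> d) (s \<otimes>\<^bsub>M\<^esub> t)"
proof (intro KM_eqI mult_KM_closed monomial_closed K.m_closed c d)
  fix x assume x: "x \<in> carrier M"
  let ?h = "\<lambda>p. monomial c s (fst p) \<otimes>\<^bsub>K\<^esub> monomial d t (snd p)"
  have z: "?h p = \<zero>\<^bsub>K\<^esub>" if "p \<in> factorizations x" "p \<noteq> (s, t)" for p
    using that c d factorizations_closed[OF that(1)] by (cases p) (auto simp: monomial_def)
  have "(\<Oplus>\<^bsub>K\<^esub>p\<in>factorizations x. ?h p) = (if s \<otimes>\<^bsub>M\<^esub> t = x then c \<otimes>\<^bsub>K\<^esub> d else \<zero>\<^bsub>K\<^esub>)"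
  proof (cases "s \<otimes>\<^bsub>M\<^esub> t = x")
    case True
    have "(\<Oplus>\<^bsub>K\<^esub>p\<in>factorizations x. ?h p) = (\<Oplus>\<^bsub>K\<^esub>p\<in>{(s, t)}. c \<otimes>\<^bsub>K\<^esub> d)"
    proof (rule K.add.finprod_mono_neutral_cong_right[OF finite_factorizations])
      show "{(s, t)} \<subseteq> factorizations x" using True s t unfolding factorizations_def by auto
      show "?h \<in> factorizations x \<rightarrow> carrier K"
        using c d by (intro convolution_summand_closed monomial_closed)
    qed (use z s t in \<open>auto simp: monomial_def\<close>)
    then show ?thesis using True c d by simp
  next
    case False
    then have "(s, t) \<notin> factorizations x" unfolding factorizations_def by auto
    then show ?thesis using False z by (auto intro!: K.add.finprod_one_eqI)
  qed
  then show "(monomial c s \<otimes>\<^bsub>KM\<^esub> monomial d t) x = monomial (c \<otimes>\<^bsub>K\<^esub> d) (s \<otimes>\<^bsub>M\<^esub> t) x"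
    unfolding mult_KM using x by (auto simp: monomial_def)
qed

text \<open>This reduces the ring laws to monomials, where they are laws of \<open>K\<close> and \<open>M\<close>.\<close>

lemma KM_induct [consumes 1, case_names zero monomial add]:
  assumes f: "f \<in> carrier KM" and zero: "P \<zero>\<^bsub>KM\<^esub>"
    and mon: "\<And>c s. c \<in> carrier K \<Longrightarrow> s \<in> carrier M \<Longrightarrow> P (monomial c s)"
    and add: "\<And>f g. f \<in> carrier KM \<Longrightarrow> g \<in> carrier KM \<Longrightarrow> P f \<Longrightarrow> P g \<Longrightarrow> P (f \<oplus>\<^bsub>KM\<^esub> g)"
  shows "P f"
proof -
  define r where "r Y = (\<lambda>x\<in>carrier M. if x \<in> Y then f x else \<zero>\<^bsub>K\<^esub>)" for Y
  have rc: "r Y \<in> carrier KM" for Y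
    using f unfolding r_def by (auto simp: KM_simps(1))
  have "P (r Y)" if "finite Y" "Y \<subseteq> carrier M" for Y
    using that
  proof (induction Y rule: finite_induct)
    case empty
    have "r {} = \<zero>\<^bsub>KM\<^esub>" unfolding r_def KM_simps by auto
    then show ?case using zero by simp
  next
    case (insert y Y)
    then have y: "y \<in> carrier M" "f y \<in> carrier K" using f by auto
    have "r (insert y Y) = monomial (f y) y \<oplus>\<^bsub>KM\<^esub> r Y"
      using insert f y unfolding r_def monomial_def
      by (auto simp: KM_simps(4) intro!: restrict_ext)
    then show ?case using add[OF monomial_closed rc] mon insert y by auto
  qed
  moreover have "r (carrier M) = f"
    using rc f by (intro KM_eqI) (auto simp: r_def)
  ultimately show ?thesis using finite_M by (metis subset_refl)
qed

lemma mult_KM_zero: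
  assumes "f \<in> carrier KM"
  shows "f \<otimes>\<^bsub>KM\<^esub> \<zero>\<^bsub>KM\<^esub> = \<zero>\<^bsub>KM\<^esub>" "\<zero>\<^bsub>KM\<^esub> \<otimes>\<^bsub>KM\<^esub> f = \<zero>\<^bsub>KM\<^esub>"
proof -
  have "\<zero>\<^bsub>KM\<^esub> x = \<zero>\<^bsub>K\<^esub>" if "x \<in> carrier M" for x using that by (simp add: KM_simps(2))
  then show "f \<otimes>\<^bsub>KM\<^esub> \<zero>\<^bsub>KM\<^esub> = \<zero>\<^bsub>KM\<^esub>" "\<zero>\<^bsub>KM\<^esub> \<otimes>\<^bsub>KM\<^esub> f = \<zero>\<^bsub>KM\<^esub>"
    unfolding mult_KM KM_simps(2) using assms
    by (auto intro!: restrict_ext K.add.finprod_one_eqI simp: factorizations_iff)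
qed

lemma mult_KM_assoc:
  assumes f: "f \<in> carrier KM" and g: "g \<in> carrier KM" and h: "h \<in> carrier KM"
  shows "f \<otimes>\<^bsub>KM\<^esub> g \<otimes>\<^bsub>KM\<^esub> h = f \<otimes>\<^bsub>KM\<^esub> (g \<otimes>\<^bsub>KM\<^esub> h)"
  using f
proof (induction f rule: KM_induct)
  case zero
  then show ?case using g h by (simp add: mult_KM_zero mult_KM_closed)
next
  case (add f f')
  then show ?case using g h by (simp add: mult_KM_distrib mult_KM_closed)
next
  case (monomial c s)
  note cs = this
  show ?case using g
  proof (induction g rule: KM_induct)
    case zero
    then show ?case using cs h by (simp add: mult_KM_zero mult_KM_closed)
  next
    case (add g g')
    then show ?case using cs h by (simp add: mult_KM_distrib mult_KM_closed)
  next
    case (monomial d t)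
    show ?case using h
    proof (induction h rule: KM_induct)
      case zero
      then show ?case using cs monomial by (simp add: mult_KM_zero mult_KM_closed)
    next
      case (add h h')
      then show ?case using cs monomial by (simp add: mult_KM_distrib mult_KM_closed)
    next
      case (monomial e u)
      then show ?case
        using cs \<open>d \<in> carrier K\<close> \<open>t \<in> carrier M\<close> by (simp add: mult_monomial K.m_assoc M.m_assoc)
    qed
  qed
qed

lemma one_KM: "\<one>\<^bsub>KM\<^esub> = monomial \<one>\<^bsub>K\<^esub> \<one>\<^bsub>M\<^esub>"
  unfolding KM_simps monomial_def ..

lemma ring_KM: "ring KM"
proof (rule ringI)
  show "abelian_group KM" by (rule abelian_group_KM)
  show "monoid KM"
  proof (rule monoidI)
    fix f assume "f \<in> carrier KM"
    then show "\<one>\<^bsub>KM\<^esub> \<otimes>\<^bsub>KM\<^esub> f = f" "f \<otimes>\<^bsub>KM\<^esub> \<one>\<^bsub>KM\<^esub> = f"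
      unfolding one_KM by (induction f rule: KM_induct)
        (simp_all add: mult_KM_zero mult_KM_distrib mult_monomial)
  qed (auto intro: KM_closed mult_KM_closed mult_KM_assoc)
qed (auto intro: mult_KM_distrib)

lemma assoc_algebra_KM: "assoc_algebra K KM"
proof -
  have "module K KM"
  proof (rule moduleI)
    show "cring K" ..
    show "abelian_group KM" by (rule abelian_group_KM)
    show "\<one>\<^bsub>K\<^esub> \<odot>\<^bsub>KM\<^esub> f = f" if "f \<in> carrier KM" for f
      using that by (intro KM_eqI KM_closed) (auto simp: KM_simps(5))
  qed (auto simp: KM_simps K.l_distr K.r_distr K.m_assoc PiE_iff intro!: restrict_ext)
  moreover have "assoc_algebra_axioms K KM"
  proof
    fix c f g assume c: "c \<in> carrier K" and f: "f \<in> carrier KM" and g: "g \<in> carrier KM"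
    note * = convolution_summand_closed[OF f g]
    have d: "(c \<odot>\<^bsub>KM\<^esub> (f \<otimes>\<^bsub>KM\<^esub> g)) x
      = (\<Oplus>\<^bsub>K\<^esub>p\<in>factorizations x. c \<otimes>\<^bsub>K\<^esub> (f (fst p) \<otimes>\<^bsub>K\<^esub> g (snd p)))" if "x \<in> carrier M" for x
      using that K.finsum_rdistr[OF finite_factorizations c *, of x] by (simp add: mult_KM KM_simps(5))
    show "(c \<odot>\<^bsub>KM\<^esub> f) \<otimes>\<^bsub>KM\<^esub> g = c \<odot>\<^bsub>KM\<^esub> (f \<otimes>\<^bsub>KM\<^esub> g)"
    proof (intro KM_eqI KM_closed mult_KM_closed c f g)
      fix x assume x: "x \<in> carrier M"
      show "((c \<odot>\<^bsub>KM\<^esub> f) \<otimes>\<^bsub>KM\<^esub> g) x = (c \<odot>\<^bsub>KM\<^esub> (f \<otimes>\<^bsub>KM\<^esub> g)) x"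
        unfolding d[OF x] unfolding mult_KM restrict_apply'[OF x]
        by (rule K.finsum_cong'[OF refl])
          (use c f g in \<open>auto simp: KM_simps(5) K.m_assoc factorizations_iff\<close>)
    qed
    show "f \<otimes>\<^bsub>KM\<^esub> (c \<odot>\<^bsub>KM\<^esub> g) = c \<odot>\<^bsub>KM\<^esub> (f \<otimes>\<^bsub>KM\<^esub> g)"
    proof (intro KM_eqI KM_closed mult_KM_closed c f g)
      fix x assume x: "x \<in> carrier M"
      show "(f \<otimes>\<^bsub>KM\<^esub> (c \<odot>\<^bsub>KM\<^esub> g)) x = (c \<odot>\<^bsub>KM\<^esub> (f \<otimes>\<^bsub>KM\<^esub> g)) x"
        unfolding d[OF x] unfolding mult_KM restrict_apply'[OF x]
        by (rule K.finsum_cong'[OF refl])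
          (use c f g in \<open>auto simp: KM_simps(5) K.m_lcomm factorizations_iff\<close>)
    qed
  qed
  ultimately show ?thesis using ring_KM by (simp add: assoc_algebra_def)
qed

sublocale A: assoc_algebra K KM by (rule assoc_algebra_KM)

lemma finsum_KM_apply:
  assumes "x \<in> carrier M" "F \<in> I \<rightarrow> carrier KM"
  shows "(\<Oplus>\<^bsub>KM\<^esub>i\<in>I. F i) x = (\<Oplus>\<^bsub>K\<^esub>i\<in>I. F i x)"
  using assms(2)
proof (induction I rule: infinite_finite_induct)
  case (insert i I)
  then have "F \<in> I \<rightarrow> carrier KM" "F i \<in> carrier KM" by auto
  moreover from this have "(\<lambda>i. F i x) \<in> I \<rightarrow> carrier K"
    using assms(1) by (auto simp: Pi_iff)
  ultimately show ?case using insert assms(1) by (simp add: KM_simps(4))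
qed (use assms(1) in \<open>auto simp: KM_simps(2)\<close>)

abbreviation emb :: "'m \<Rightarrow> 'm \<Rightarrow> 'k" where "emb \<equiv> monomial \<one>\<^bsub>K\<^esub>"

lemma monomial_eq_smult: "c \<in> carrier K \<Longrightarrow> monomial c s = c \<odot>\<^bsub>KM\<^esub> emb s"
  by (intro KM_eqI A.smult_closed monomial_closed) (auto simp: monomial_def KM_simps(5))

lemma left_ideal_smult:
  assumes N: "left_ideal N KM" and c: "c \<in> carrier K" and f: "f \<in> N"
  shows "c \<odot>\<^bsub>KM\<^esub> f \<in> N"
proof -
  have fc: "f \<in> carrier KM" using A.left_ideal_carrier[OF N f] .
  have "c \<odot>\<^bsub>KM\<^esub> f = (c \<odot>\<^bsub>KM\<^esub> \<one>\<^bsub>KM\<^esub>) \<otimes>\<^bsub>KM\<^esub> f"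
    using c fc by (simp add: A.smult_mult_left)
  then show ?thesis using A.left_ideal_mult[OF N _ f] c by simp
qed

lemma finsum_KM_const:
  assumes v: "v \<in> carrier KM"
  shows "(\<Oplus>\<^bsub>KM\<^esub>_\<in>I. v) = ([card I] \<cdot>\<^bsub>K\<^esub> \<one>\<^bsub>K\<^esub>) \<odot>\<^bsub>KM\<^esub> v"
proof (induction I rule: infinite_finite_induct)
  case (insert i I)
  have "[card (insert i I)] \<cdot>\<^bsub>K\<^esub> \<one>\<^bsub>K\<^esub> = \<one>\<^bsub>K\<^esub> \<oplus>\<^bsub>K\<^esub> [card I] \<cdot>\<^bsub>K\<^esub> \<one>\<^bsub>K\<^esub>"
    using insert by (simp add: K.a_comm)
  then show ?case using insert v by (simp add: A.smult_l_distr)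
qed (use v in auto)

lemma finsum_mult_finsum:
  assumes "finite I" "finite J" "f \<in> I \<rightarrow> carrier KM" "g \<in> J \<rightarrow> carrier KM"
  shows "(\<Oplus>\<^bsub>KM\<^esub>i\<in>I. f i) \<otimes>\<^bsub>KM\<^esub> (\<Oplus>\<^bsub>KM\<^esub>j\<in>J. g j) = (\<Oplus>\<^bsub>KM\<^esub>p\<in>I \<times> J. f (fst p) \<otimes>\<^bsub>KM\<^esub> g (snd p))"
  using assms(1,3)
proof (induction I rule: finite_induct)
  case empty
  then show ?case using assms by simp
next
  case (insert i I)
  then have fI: "f \<in> I \<rightarrow> carrier KM" "f i \<in> carrier KM" by auto
  let ?h = "\<lambda>p. f (fst p) \<otimes>\<^bsub>KM\<^esub> g (snd p)"
  have "(\<Oplus>\<^bsub>KM\<^esub>i\<in>insert i I. f i) \<otimes>\<^bsub>KM\<^esub> (\<Oplus>\<^bsub>KM\<^esub>j\<in>J. g j)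
    = f i \<otimes>\<^bsub>KM\<^esub> (\<Oplus>\<^bsub>KM\<^esub>j\<in>J. g j) \<oplus>\<^bsub>KM\<^esub> (\<Oplus>\<^bsub>KM\<^esub>p\<in>I \<times> J. ?h p)"
    using insert fI assms(4) by (simp add: A.l_distr)
  also have "f i \<otimes>\<^bsub>KM\<^esub> (\<Oplus>\<^bsub>KM\<^esub>j\<in>J. g j) = (\<Oplus>\<^bsub>KM\<^esub>j\<in>J. f i \<otimes>\<^bsub>KM\<^esub> g j)"
    using fI assms(2,4) by (intro A.finsum_rdistr)
  also have "\<dots> = (\<Oplus>\<^bsub>KM\<^esub>p\<in>Pair i ` J. ?h p)"
    using fI assms(4) by (subst A.finsum_reindex) (auto simp: inj_on_def Pi_iff)
  also have "\<dots> \<oplus>\<^bsub>KM\<^esub> (\<Oplus>\<^bsub>KM\<^esub>p\<in>I \<times> J. ?h p) = (\<Oplus>\<^bsub>KM\<^esub>p\<in>Pair i ` J \<union> I \<times> J. ?h p)"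
    using insert fI assms(2,4) by (intro A.finsum_Un_disjoint[symmetric]) (auto simp: Pi_iff)
  also have "Pair i ` J \<union> I \<times> J = insert i I \<times> J" by auto
  finally show ?case .
qed

text \<open>
  Every left ideal \<open>N\<close> is the image of a linear projection, given here by its values \<open>p s\<close> on the
  basis.  Take a maximal set \<open>Y\<close> of basis elements whose span meets \<open>N\<close> trivially.  By maximality,
  for \<open>s \<notin> Y\<close> there is an element \<open>p s\<close> of \<open>N\<close> with coefficient \<open>\<one>\<close> at \<open>s\<close> and no other
  coefficients outside \<open>Y\<close>.  With \<open>p s = \<zero>\<close> for \<open>s \<in> Y\<close>, an element of \<open>N\<close> and its image agree
  outside \<open>Y\<close>, hence everywhere.
\<close>

lemma ex_projection_left_ideal:
  assumes N: "left_ideal N KM"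
  obtains p where "\<And>s. s \<in> carrier M \<Longrightarrow> p s \<in> N"
    "\<And>f. f \<in> N \<Longrightarrow> (\<Oplus>\<^bsub>KM\<^esub>s\<in>carrier M. f s \<odot>\<^bsub>KM\<^esub> p s) = f"
proof -
  define triv where "triv Y \<longleftrightarrow> Y \<subseteq> carrier M \<and>
    (\<forall>f\<in>N. (\<forall>x\<in>carrier M - Y. f x = \<zero>\<^bsub>K\<^esub>) \<longrightarrow> f = \<zero>\<^bsub>KM\<^esub>)" for Y
  have Nc: "f \<in> carrier KM" if "f \<in> N" for f using A.left_ideal_carrier[OF N that] .
  have z: "\<zero>\<^bsub>KM\<^esub> x = \<zero>\<^bsub>K\<^esub>" if "x \<in> carrier M" for x using that by (simp add: KM_simps(2))
  have "finite {Y. triv Y}"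
    by (rule finite_subset[of _ "Pow (carrier M)"]) (auto simp: triv_def)
  moreover have "triv {}"
    unfolding triv_def using Nc z by (auto intro!: KM_eqI)
  ultimately obtain Y where Y: "triv Y" "\<And>Z. triv Z \<Longrightarrow> Y \<subseteq> Z \<Longrightarrow> Y = Z"
    using finite_has_maximal[of "{Y. triv Y}"] by blast
  have "\<exists>f\<in>N. f s = \<one>\<^bsub>K\<^esub> \<and> (\<forall>x\<in>carrier M - insert s Y. f x = \<zero>\<^bsub>K\<^esub>)"
    if s: "s \<in> carrier M - Y" for s
  proof -
    have "\<not> triv (insert s Y)" using Y(2)[of "insert s Y"] s by blast
    then obtain f where f: "f \<in> N" "\<forall>x\<in>carrier M - insert s Y. f x = \<zero>\<^bsub>K\<^esub>" "f \<noteq> \<zero>\<^bsub>KM\<^esub>"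
      using Y(1) s unfolding triv_def by blast
    have fs: "f s \<in> carrier K" using Nc[OF f(1)] s by simp
    have "f s \<noteq> \<zero>\<^bsub>K\<^esub>"
      using Y(1) f s unfolding triv_def by blast
    then have "f s \<in> Units K" using fs K.field_Units by simp
    then have i: "inv\<^bsub>K\<^esub> f s \<in> carrier K" "inv\<^bsub>K\<^esub> f s \<otimes>\<^bsub>K\<^esub> f s = \<one>\<^bsub>K\<^esub>" by auto
    then show ?thesis
      using f s left_ideal_smult[OF N i(1) f(1)]
      by (intro bexI[of _ "inv\<^bsub>K\<^esub> f s \<odot>\<^bsub>KM\<^esub> f"]) (auto simp: KM_simps(5))
  qed
  then obtain q where q: "\<And>s. s \<in> carrier M - Y \<Longrightarrow> q s \<in> N \<and> q s s = \<one>\<^bsub>K\<^esub> \<and>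
      (\<forall>x\<in>carrier M - insert s Y. q s x = \<zero>\<^bsub>K\<^esub>)"
    by metis
  define p where "p s = (if s \<in> Y then \<zero>\<^bsub>KM\<^esub> else q s)" for s
  have pN: "p s \<in> N" if "s \<in> carrier M" for s
    using that q A.left_ideal_zero[OF N] unfolding p_def by auto
  have px: "p s x = (if s = x then \<one>\<^bsub>K\<^esub> else \<zero>\<^bsub>K\<^esub>)" if "x \<in> carrier M - Y" "s \<in> carrier M" for s x
    using that q[of s] z[of x] unfolding p_def by auto
  have "(\<Oplus>\<^bsub>KM\<^esub>s\<in>carrier M. f s \<odot>\<^bsub>KM\<^esub> p s) = f" if f: "f \<in> N" for f
  proof -
    let ?g = "\<Oplus>\<^bsub>KM\<^esub>s\<in>carrier M. f s \<odot>\<^bsub>KM\<^esub> p s"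
    have fc: "f \<in> carrier KM" using Nc[OF f] .
    have gN: "?g \<in> N"
      using fc by (intro A.left_ideal_finsum[OF N] left_ideal_smult[OF N] pN) auto
    have gc: "?g \<in> carrier KM" using Nc[OF gN] .
    have dN: "f \<ominus>\<^bsub>KM\<^esub> ?g \<in> N"
      unfolding a_minus_def using A.left_ideal_add[OF N f A.left_ideal_uminus[OF N gN]] .
    have dz: "(f \<ominus>\<^bsub>KM\<^esub> ?g) x = \<zero>\<^bsub>K\<^esub>" if x: "x \<in> carrier M - Y" for x
    proof -
      have xc: "x \<in> carrier M" using x by simp
      have "?g x = (\<Oplus>\<^bsub>K\<^esub>s\<in>carrier M. (f s \<odot>\<^bsub>KM\<^esub> p s) x)"
        using xc fc Nc[OF pN] by (intro finsum_KM_apply) auto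
      also have "\<dots> = (\<Oplus>\<^bsub>K\<^esub>s\<in>carrier M. if x = s then f s else \<zero>\<^bsub>K\<^esub>)"
        using xc fc px[OF x] by (intro K.finsum_cong') (auto simp: KM_simps(5))
      also have "\<dots> = f x"
        using xc fc by (intro K.finsum_singleton) auto
      finally have "?g x = f x" .
      moreover have "(f \<ominus>\<^bsub>KM\<^esub> ?g \<oplus>\<^bsub>KM\<^esub> ?g) x = f x"
        using fc gc by (simp add: a_minus_def A.a_assoc A.l_neg)
      then have "(f \<ominus>\<^bsub>KM\<^esub> ?g) x \<oplus>\<^bsub>K\<^esub> ?g x = f x"
        using xc by (simp add: KM_simps(4))
      moreover have "(f \<ominus>\<^bsub>KM\<^esub> ?g) x \<in> carrier K" "f x \<in> carrier K"
        using KM_apply[of "f \<ominus>\<^bsub>KM\<^esub> ?g" x] fc gc xc by auto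
      ultimately show ?thesis by simp
    qed
    have "\<forall>f\<in>N. (\<forall>x\<in>carrier M - Y. f x = \<zero>\<^bsub>K\<^esub>) \<longrightarrow> f = \<zero>\<^bsub>KM\<^esub>"
      using Y(1) unfolding triv_def by (rule conjunct2)
    then have "f \<ominus>\<^bsub>KM\<^esub> ?g = \<zero>\<^bsub>KM\<^esub>" using dN dz by simp
    then show ?thesis using A.eq_if_minus_zero[OF fc gc] by simp
  qed
  then show ?thesis using pN that[of p] by simp
qed

end

section \<open>Algebras of finite inverse monoids\<close>

locale finite_inverse_monoid_algebra = finite_monoid_algebra K M + M: inverse_monoid M
  for K :: "('k, 'r) ring_scheme" and M :: "('m, 's) monoid_scheme"
begin

lemma wf_natural_less: "wf {(t, s). t \<preceq> s \<and> t \<noteq> s}" (is "wf ?R")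
proof (rule finite_acyclic_wf)
  show "finite ?R"
    by (rule finite_subset[of _ "carrier M \<times> carrier M"]) (auto dest: M.natural_le_carrier)
  have "trans ?R"
    using M.natural_le_trans M.natural_le_antisym by (intro transI) blast
  then show "acyclic ?R" by (intro acyclicI) (auto simp: trancl_id)
qed

lemma finite_below [simp]: "finite {t. t \<preceq> s}"
  by (rule finite_subset[OF _ finite_M]) (auto dest: M.natural_le_carrier)

lemma finite_strictly_below [simp]: "finite {t. t \<preceq> s \<and> t \<noteq> s}"
  by (rule finite_subset[OF _ finite_below]) auto

lemma below_eq_insert: "s \<in> carrier M \<Longrightarrow> {t. t \<preceq> s} = insert s {t. t \<preceq> s \<and> t \<noteq> s}"
  by auto

text \<open>
  Recursion along the natural order: \<open>b s\<close> is \<open>emb s\<close> minus the sum of all \<open>b t\<close> with \<open>t\<close> strictly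
  below \<open>s\<close>.
\<close>

lemma ex_moebius_basis:
  "\<exists>b. \<forall>s\<in>carrier M. b s \<in> carrier KM \<and> emb s = (\<Oplus>\<^bsub>KM\<^esub>t\<in>{t. t \<preceq> s}. b t)"
proof -
  let ?B = "\<lambda>s. {t. t \<preceq> s \<and> t \<noteq> s}"
  define P where "P b s r \<longleftrightarrow> (s \<in> carrier M \<longrightarrow> b \<in> ?B s \<rightarrow> carrier KM \<longrightarrow>
    r \<in> carrier KM \<and> r \<oplus>\<^bsub>KM\<^esub> (\<Oplus>\<^bsub>KM\<^esub>t\<in>?B s. b t) = emb s)" for b s r
  have "\<exists>b. \<forall>s. P b s (b s)"
  proof (rule dependent_wf_choice[OF wf_natural_less])
    fix b b' :: "'m \<Rightarrow> 'm \<Rightarrow> 'k" and s r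
    assume eq: "\<And>t. (t, s) \<in> {(t, s). t \<preceq> s \<and> t \<noteq> s} \<Longrightarrow> b t = b' t"
    then have "b \<in> ?B s \<rightarrow> carrier KM \<longleftrightarrow> b' \<in> ?B s \<rightarrow> carrier KM" by (auto simp: Pi_iff)
    moreover have "(\<Oplus>\<^bsub>KM\<^esub>t\<in>?B s. b t) = (\<Oplus>\<^bsub>KM\<^esub>t\<in>?B s. b' t)" if "b' \<in> ?B s \<rightarrow> carrier KM"
      using that eq by (intro A.finsum_cong') auto
    ultimately show "P b s r = P b' s r" unfolding P_def by auto
  next
    fix s and b :: "'m \<Rightarrow> 'm \<Rightarrow> 'k"
    show "\<exists>r. P b s r"
      unfolding P_def
      by (intro exI[of _ "emb s \<ominus>\<^bsub>KM\<^esub> (\<Oplus>\<^bsub>KM\<^esub>t\<in>?B s. b t)"])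
        (auto simp: a_minus_def A.a_assoc A.l_neg)
  qed
  then obtain b where b: "\<And>s. P b s (b s)" by blast
  have c: "b s \<in> carrier KM" if "s \<in> carrier M" for s
    using that
  proof (induction s rule: wf_induct_rule[OF wf_natural_less])
    case (1 s)
    then have "b \<in> ?B s \<rightarrow> carrier KM" by (auto dest: M.natural_le_carrier)
    then show ?case using b[of s] 1(2) unfolding P_def by blast
  qed
  have "emb s = (\<Oplus>\<^bsub>KM\<^esub>t\<in>{t. t \<preceq> s}. b t)" if s: "s \<in> carrier M" for s
  proof -
    have bc: "b \<in> ?B s \<rightarrow> carrier KM" using c by (auto dest: M.natural_le_carrier)
    then have "emb s = b s \<oplus>\<^bsub>KM\<^esub> (\<Oplus>\<^bsub>KM\<^esub>t\<in>?B s. b t)"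
      using b[of s] s unfolding P_def by simp
    also have "\<dots> = (\<Oplus>\<^bsub>KM\<^esub>t\<in>insert s (?B s). b t)"
      using c[OF s] bc by (intro A.finsum_insert[symmetric]) auto
    finally show ?thesis unfolding below_eq_insert[OF s] .
  qed
  then show ?thesis using c by blast
qed

text \<open>
  The groupoid basis of the algebra, obtained from the basis \<open>emb\<close> by Moebius inversion.
\<close>

definition mob :: "'m \<Rightarrow> 'm \<Rightarrow> 'k" where
  "mob = (SOME b. \<forall>s\<in>carrier M. b s \<in> carrier KM \<and> emb s = (\<Oplus>\<^bsub>KM\<^esub>t\<in>{t. t \<preceq> s}. b t))"

lemma mob_closed [simp]: "s \<in> carrier M \<Longrightarrow> mob s \<in> carrier KM"
  and emb_eq_sum_mob: "s \<in> carrier M \<Longrightarrow> emb s = (\<Oplus>\<^bsub>KM\<^esub>t\<in>{t. t \<preceq> s}. mob t)"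
  using someI_ex[OF ex_moebius_basis] unfolding mob_def[symmetric] by auto

lemma mob_funcset: "mob \<in> {t. t \<preceq> s} \<rightarrow> carrier KM"
  by (auto dest: M.natural_le_carrier)

lemma card_below_less:
  assumes "t \<preceq> s" "t \<noteq> s"
  shows "card {u. u \<preceq> t} < card {u. u \<preceq> s}"
proof (rule psubset_card_mono[OF finite_below])
  have "s \<notin> {u. u \<preceq> t}" using assms M.natural_le_antisym by blast
  moreover have "s \<in> {u. u \<preceq> s}" using M.natural_le_carrier(2)[OF assms(1)] by simp
  ultimately show "{u. u \<preceq> t} \<subset> {u. u \<preceq> s}"
    using M.natural_le_trans[OF _ assms(1)] by blast
qed

lemma card_below_le: "t \<preceq> s \<Longrightarrow> card {u. u \<preceq> t} \<le> card {u. u \<preceq> s}"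
  using card_below_less[of t s] by (cases "t = s") auto

text \<open>
  Expand \<open>emb s \<otimes> emb t = emb (s \<otimes> t)\<close> in the new basis.  On the left this gives all products
  \<open>mob x \<otimes> mob y\<close> with \<open>x\<close> below \<open>s\<close> and \<open>y\<close> below \<open>t\<close>; on the right, by unique factorization below
  \<open>s \<otimes> t\<close>, all \<open>mob (x \<otimes> y)\<close> with \<open>x\<close> and \<open>y\<close> composable.  By induction the terms other than the one
  for \<open>(s, t)\<close> agree, hence so does this one.
\<close>

lemma mob_mult:
  assumes "s \<in> carrier M" "t \<in> carrier M"
  shows "mob s \<otimes>\<^bsub>KM\<^esub> mob t = (if M.src s = M.tgt t then mob (s \<otimes>\<^bsub>M\<^esub> t) else \<zero>\<^bsub>KM\<^esub>)"
  using assms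
proof (induction "card {u. u \<preceq> s} + card {u. u \<preceq> t}" arbitrary: s t rule: less_induct)
  case less
  note [simp] = less.prems
  define g where "g p = (if M.src (fst p) = M.tgt (snd p) then mob (fst p \<otimes>\<^bsub>M\<^esub> snd p) else \<zero>\<^bsub>KM\<^esub>)" for p
  let ?P = "{u. u \<preceq> s} \<times> {u. u \<preceq> t}"
  let ?h = "\<lambda>p. mob (fst p) \<otimes>\<^bsub>KM\<^esub> mob (snd p)"
  let ?m = "\<lambda>(x, y). x \<otimes>\<^bsub>M\<^esub> y"
  let ?D = "{(x, y). x \<preceq> s \<and> y \<preceq> t \<and> M.src x = M.tgt y}"
  have bij: "bij_betw ?m ?D {z. z \<preceq> s \<otimes>\<^bsub>M\<^esub> t}" by (rule M.bij_betw_below_mult) simp_all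
  have st: "(s, t) \<in> ?P" by simp
  have P: "fst p \<in> carrier M" "snd p \<in> carrier M" if "p \<in> ?P" for p
    using that by (auto dest: M.natural_le_carrier)
  have gc: "g \<in> ?P \<rightarrow> carrier KM" and hc: "?h \<in> ?P \<rightarrow> carrier KM"
    using P unfolding g_def by (auto simp: Pi_iff)
  have split: "(\<Oplus>\<^bsub>KM\<^esub>p\<in>?P. k p) = k (s, t) \<oplus>\<^bsub>KM\<^esub> (\<Oplus>\<^bsub>KM\<^esub>p\<in>?P - {(s, t)}. k p)"
    if "k \<in> ?P \<rightarrow> carrier KM" for k
  proof -
    have "?P = insert (s, t) (?P - {(s, t)})" using st by blast
    moreover have "(\<Oplus>\<^bsub>KM\<^esub>p\<in>insert (s, t) (?P - {(s, t)}). k p)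
      = k (s, t) \<oplus>\<^bsub>KM\<^esub> (\<Oplus>\<^bsub>KM\<^esub>p\<in>?P - {(s, t)}. k p)"
      using that st by (intro A.finsum_insert) auto
    ultimately show ?thesis by simp
  qed
  have IH: "?h p = g p" if p: "p \<in> ?P - {(s, t)}" for p
  proof -
    obtain x y where xy: "p = (x, y)" "x \<preceq> s" "y \<preceq> t" "x \<noteq> s \<or> y \<noteq> t"
      using p by auto
    then have "card {u. u \<preceq> x} + card {u. u \<preceq> y}
      < card {u. u \<preceq> s} + card {u. u \<preceq> t}"
      using card_below_less[of x s] card_below_less[of y t] card_below_le[of x s] card_below_le[of y t]
      by fastforce
    from less.hyps[OF this] show ?thesis
      using xy M.natural_le_carrier unfolding g_def by simp
  qed
  have rest: "(\<Oplus>\<^bsub>KM\<^esub>p\<in>?P - {(s, t)}. ?h p) = (\<Oplus>\<^bsub>KM\<^esub>p\<in>?P - {(s, t)}. g p)"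
    using IH gc by (intro A.finsum_cong') auto
  have "?h (s, t) \<oplus>\<^bsub>KM\<^esub> (\<Oplus>\<^bsub>KM\<^esub>p\<in>?P - {(s, t)}. ?h p) = emb s \<otimes>\<^bsub>KM\<^esub> emb t"
    unfolding split[OF hc, symmetric] emb_eq_sum_mob[OF less.prems(1)] emb_eq_sum_mob[OF less.prems(2)]
    by (intro finsum_mult_finsum[symmetric] mob_funcset finite_below)
  also have "\<dots> = emb (s \<otimes>\<^bsub>M\<^esub> t)"
    by (simp add: mult_monomial)
  also have "\<dots> = (\<Oplus>\<^bsub>KM\<^esub>z\<in>{z. z \<preceq> s \<otimes>\<^bsub>M\<^esub> t}. mob z)"
    by (rule emb_eq_sum_mob) simp
  also have "\<dots> = (\<Oplus>\<^bsub>KM\<^esub>p\<in>?D. mob (?m p))"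
    using bij mob_funcset[of "s \<otimes>\<^bsub>M\<^esub> t"] A.finsum_reindex[of mob ?m ?D]
    unfolding bij_betw_def by simp
  also have "\<dots> = (\<Oplus>\<^bsub>KM\<^esub>p\<in>?P. g p)"
    using gc by (intro A.add.finprod_mono_neutral_cong_left) (auto simp: g_def intro!: mob_closed M.m_closed intro: M.natural_le_carrier(1))
  also have "\<dots> = g (s, t) \<oplus>\<^bsub>KM\<^esub> (\<Oplus>\<^bsub>KM\<^esub>p\<in>?P - {(s, t)}. g p)"
    by (rule split[OF gc])
  finally have "?h (s, t) \<oplus>\<^bsub>KM\<^esub> (\<Oplus>\<^bsub>KM\<^esub>p\<in>?P - {(s, t)}. g p)
    = g (s, t) \<oplus>\<^bsub>KM\<^esub> (\<Oplus>\<^bsub>KM\<^esub>p\<in>?P - {(s, t)}. g p)"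
    unfolding rest .
  moreover have "(\<Oplus>\<^bsub>KM\<^esub>p\<in>?P - {(s, t)}. g p) \<in> carrier KM"
    using gc by (intro A.finsum_closed) auto
  moreover have "?h (s, t) \<in> carrier KM" "g (s, t) \<in> carrier KM" using hc gc st by auto
  ultimately have "?h (s, t) = g (s, t)" by simp
  then show ?case unfolding g_def by simp
qed

lemma one_eq_sum_mob: "\<one>\<^bsub>KM\<^esub> = (\<Oplus>\<^bsub>KM\<^esub>e\<in>{e \<in> carrier M. M.tgt e = e}. mob e)"
  unfolding one_KM using emb_eq_sum_mob[of "\<one>\<^bsub>M\<^esub>"] by (simp add: M.below_one)

lemma KM_finsum_induct:
  assumes "finite I" "P \<zero>\<^bsub>KM\<^esub>" "\<And>i. i \<in> I \<Longrightarrow> f i \<in> carrier KM \<and> P (f i)"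
    and "\<And>f g. f \<in> carrier KM \<Longrightarrow> g \<in> carrier KM \<Longrightarrow> P f \<Longrightarrow> P g \<Longrightarrow> P (f \<oplus>\<^bsub>KM\<^esub> g)"
  shows "P (\<Oplus>\<^bsub>KM\<^esub>i\<in>I. f i)"
  using assms(1,3)
proof (induction I rule: finite_induct)
  case (insert i I)
  then have "f \<in> I \<rightarrow> carrier KM" "f i \<in> carrier KM" by auto
  then show ?case using insert assms(4) by simp
qed (use assms(2) in simp)

lemma mob_induct [consumes 1, case_names zero mob add]:
  assumes f: "f \<in> carrier KM" and zero: "P \<zero>\<^bsub>KM\<^esub>"
    and mob: "\<And>c s. c \<in> carrier K \<Longrightarrow> s \<in> carrier M \<Longrightarrow> P (c \<odot>\<^bsub>KM\<^esub> mob s)"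
    and add: "\<And>f g. f \<in> carrier KM \<Longrightarrow> g \<in> carrier KM \<Longrightarrow> P f \<Longrightarrow> P g \<Longrightarrow> P (f \<oplus>\<^bsub>KM\<^esub> g)"
  shows "P f"
  using f
proof (induction f rule: KM_induct)
  case (monomial c s)
  have "monomial c s = c \<odot>\<^bsub>KM\<^esub> (\<Oplus>\<^bsub>KM\<^esub>t\<in>{t. t \<preceq> s}. mob t)"
    using monomial by (simp add: monomial_eq_smult[of c] emb_eq_sum_mob)
  also have "\<dots> = (\<Oplus>\<^bsub>KM\<^esub>t\<in>{t. t \<preceq> s}. c \<odot>\<^bsub>KM\<^esub> mob t)"
    using monomial mob_funcset by (intro A.finsum_smult_ldistr) auto
  finally show ?case
    using monomial(1) zero mob add M.natural_le_carrier
    by (auto intro!: KM_finsum_induct[where P = P])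
qed (use zero add in auto)

text \<open>The basis change is unitriangular.\<close>

lemma mob_apply:
  assumes "s \<in> carrier M" "x \<in> carrier M"
  shows "(\<not> x \<preceq> s \<longrightarrow> mob s x = \<zero>\<^bsub>K\<^esub>) \<and> (x = s \<longrightarrow> mob s x = \<one>\<^bsub>K\<^esub>)"
  using assms(1)
proof (induction s rule: wf_induct_rule[OF wf_natural_less])
  case (1 s)
  let ?B = "{t. t \<preceq> s \<and> t \<noteq> s}"
  have s: "s \<in> carrier M" using 1(2) .
  have c: "mob \<in> ?B \<rightarrow> carrier KM" by (auto dest: M.natural_le_carrier)
  have "emb s = mob s \<oplus>\<^bsub>KM\<^esub> (\<Oplus>\<^bsub>KM\<^esub>t\<in>?B. mob t)"
    unfolding emb_eq_sum_mob[OF s] below_eq_insert[OF s] using c s by (intro A.finsum_insert) auto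
  then have "emb s x = mob s x \<oplus>\<^bsub>K\<^esub> (\<Oplus>\<^bsub>K\<^esub>t\<in>?B. mob t x)"
    using assms(2) finsum_KM_apply[OF assms(2) c] by (simp add: KM_simps(4))
  moreover have "(\<Oplus>\<^bsub>K\<^esub>t\<in>?B. mob t x) = \<zero>\<^bsub>K\<^esub>" if "\<not> x \<preceq> s \<or> x = s"
  proof (rule K.add.finprod_one_eqI)
    fix t assume t: "t \<in> ?B"
    then have "\<not> x \<preceq> t" using that M.natural_le_trans M.natural_le_antisym by blast
    then show "mob t x = \<zero>\<^bsub>K\<^esub>" using 1(1)[of t] t M.natural_le_carrier by blast
  qed
  ultimately have "mob s x = emb s x" if "\<not> x \<preceq> s \<or> x = s"
    using that s assms(2) by simp
  then show ?case using assms(2) s by (auto simp: monomial_def)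
qed

text \<open>
  Let \<open>x\<close> be the sum of the groupoid basis over the H-class of \<open>a\<close>.  It is nonzero, having
  coefficient \<open>\<one>\<close> at \<open>a\<close>.  For an arrow \<open>t\<close> from the target to the source of \<open>a\<close>, right
  multiplication by \<open>t \<otimes> h\<close>, with \<open>h\<close> in the H-class, permutes that class, so that \<open>x \<otimes> mob t \<otimes> x\<close> is
  \<open>x\<close> times the size of the H-class; for any other \<open>t\<close> it is zero.  If that size vanishes in \<open>K\<close>, this
  contradicts semiprimeness.
\<close>

lemma semisimple_imp_card_hclass:
  assumes ss: "semisimple_ring KM" and a: "a \<in> carrier M"
  shows "[card (M.hclass a)] \<cdot>\<^bsub>K\<^esub> \<one>\<^bsub>K\<^esub> \<noteq> \<zero>\<^bsub>K\<^esub>"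
proof
  assume n0: "[card (M.hclass a)] \<cdot>\<^bsub>K\<^esub> \<one>\<^bsub>K\<^esub> = \<zero>\<^bsub>K\<^esub>"
  let ?H = "M.hclass a"
  define x where "x = (\<Oplus>\<^bsub>KM\<^esub>g\<in>?H. mob g)"
  have fin: "finite ?H" using M.hclass_carrier finite_M by (rule finite_subset)
  have Hc: "g \<in> carrier M" if "g \<in> ?H" for g using that M.hclass_carrier by blast
  have mobH: "mob \<in> ?H \<rightarrow> carrier KM" using Hc by auto
  have xc: "x \<in> carrier KM" unfolding x_def using mobH by simp
  have null_mob: "x \<otimes>\<^bsub>KM\<^esub> mob t \<otimes>\<^bsub>KM\<^esub> x = \<zero>\<^bsub>KM\<^esub>" if t: "t \<in> carrier M" for t
  proof -
    have srcH: "M.src g = M.src a" and tgtH: "M.tgt g = M.tgt a" if "g \<in> ?H" for g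
      using that unfolding M.hclass_def by auto
    consider "M.src a \<noteq> M.tgt t" | "M.src t \<noteq> M.tgt a"
      | "M.src a = M.tgt t" "M.src t = M.tgt a" by blast
    then show ?thesis
    proof cases
      case 1
      have "x \<otimes>\<^bsub>KM\<^esub> mob t = (\<Oplus>\<^bsub>KM\<^esub>g\<in>?H. mob g \<otimes>\<^bsub>KM\<^esub> mob t)"
        unfolding x_def using fin t mobH by (intro A.finsum_ldistr) auto
      also have "\<dots> = \<zero>\<^bsub>KM\<^esub>"
        using 1 t Hc srcH by (intro A.add.finprod_one_eqI) (simp add: mob_mult)
      finally show ?thesis using xc by simp
    next
      case 2
      have "mob t \<otimes>\<^bsub>KM\<^esub> x = (\<Oplus>\<^bsub>KM\<^esub>g\<in>?H. mob t \<otimes>\<^bsub>KM\<^esub> mob g)"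
        unfolding x_def using fin t mobH by (intro A.finsum_rdistr) auto
      also have "\<dots> = \<zero>\<^bsub>KM\<^esub>"
        using 2 t Hc tgtH by (intro A.add.finprod_one_eqI) (simp add: mob_mult)
      finally show ?thesis using xc t by (simp add: A.m_assoc)
    next
      case 3
      have absorb: "x \<otimes>\<^bsub>KM\<^esub> mob t \<otimes>\<^bsub>KM\<^esub> mob h = x" if h: "h \<in> ?H" for h
      proof -
        define u where "u = t \<otimes>\<^bsub>M\<^esub> h"
        have hc: "h \<in> carrier M" using Hc[OF h] .
        have u: "u \<in> carrier M" "M.tgt u = M.src a" "M.src u = M.src a"
          unfolding u_def using M.composable[OF t hc] 3 t hc srcH[OF h] tgtH[OF h] by auto
        have bij: "bij_betw (\<lambda>g. g \<otimes>\<^bsub>M\<^esub> u) ?H (M.hclass (a \<otimes>\<^bsub>M\<^esub> u))"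
          using M.bij_betw_hclass_mult_right[OF a u(1,2)] .
        have Hu: "M.hclass (a \<otimes>\<^bsub>M\<^esub> u) = ?H"
          unfolding M.hclass_def using M.composable[of a u] a u by simp
        have "x \<otimes>\<^bsub>KM\<^esub> mob t \<otimes>\<^bsub>KM\<^esub> mob h = x \<otimes>\<^bsub>KM\<^esub> mob u"
          unfolding u_def using xc t hc 3 tgtH[OF h] by (simp add: A.m_assoc mob_mult)
        also have "\<dots> = (\<Oplus>\<^bsub>KM\<^esub>g\<in>?H. mob g \<otimes>\<^bsub>KM\<^esub> mob u)"
          unfolding x_def using fin u mobH by (intro A.finsum_ldistr) auto
        also have "\<dots> = (\<Oplus>\<^bsub>KM\<^esub>g\<in>?H. mob (g \<otimes>\<^bsub>M\<^esub> u))"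
          using Hc u srcH by (intro A.finsum_cong') (auto simp: mob_mult)
        also have "\<dots> = (\<Oplus>\<^bsub>KM\<^esub>g\<in>(\<lambda>g. g \<otimes>\<^bsub>M\<^esub> u) ` ?H. mob g)"
          using bij Hu mobH by (intro A.finsum_reindex[symmetric]) (auto simp: bij_betw_def)
        also have "\<dots> = x"
          unfolding x_def bij_betw_imp_surj_on[OF bij] Hu ..
        finally show ?thesis .
      qed
      have "x \<otimes>\<^bsub>KM\<^esub> mob t \<otimes>\<^bsub>KM\<^esub> x = (\<Oplus>\<^bsub>KM\<^esub>h\<in>?H. x \<otimes>\<^bsub>KM\<^esub> mob t \<otimes>\<^bsub>KM\<^esub> mob h)"
        by (subst (2) x_def, rule A.finsum_rdistr) (use fin xc t mobH in auto)
      also have "\<dots> = (\<Oplus>\<^bsub>KM\<^esub>h\<in>?H. x)"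
        using xc absorb by (intro A.finsum_cong') auto
      also have "\<dots> = \<zero>\<^bsub>KM\<^esub>"
        using finsum_KM_const[OF xc, of ?H] n0 xc by simp
      finally show ?thesis .
    qed
  qed
  have "x \<otimes>\<^bsub>KM\<^esub> f \<otimes>\<^bsub>KM\<^esub> x = \<zero>\<^bsub>KM\<^esub>" if "f \<in> carrier KM" for f
    using that
  proof (induction f rule: mob_induct)
    case (mob c s)
    then show ?case
      using xc null_mob by (simp add: A.smult_mult_left A.smult_mult_right)
  qed (use xc in \<open>simp_all add: A.l_distr A.r_distr\<close>)
  then have "x = \<zero>\<^bsub>KM\<^esub>" using A.semisimple_imp_semiprime[OF ss xc] by blast
  moreover have "x a = \<one>\<^bsub>K\<^esub>"
  proof -
    have "x a = (\<Oplus>\<^bsub>K\<^esub>g\<in>?H. mob g a)"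
      unfolding x_def using finsum_KM_apply[OF a mobH] .
    also have "\<dots> = (\<Oplus>\<^bsub>K\<^esub>g\<in>?H. if a = g then \<one>\<^bsub>K\<^esub> else \<zero>\<^bsub>K\<^esub>)"
    proof (rule K.finsum_cong'[OF refl])
      fix g assume g: "g \<in> ?H"
      then have "a \<preceq> g \<Longrightarrow> a = g"
        using M.natural_le_eq_tgt[of a g] unfolding M.hclass_def by auto
      then show "mob g a = (if a = g then \<one>\<^bsub>K\<^esub> else \<zero>\<^bsub>K\<^esub>)"
        using mob_apply[OF Hc[OF g] a] by auto
    qed auto
    also have "\<dots> = \<one>\<^bsub>K\<^esub>"
      using K.finsum_singleton[OF M.hclass_self[OF a] fin, of "\<lambda>_. \<one>\<^bsub>K\<^esub>"] by simp
    finally show ?thesis .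
  qed
  ultimately show False using a by (simp add: KM_simps(2))
qed

text \<open>
  Maschke's averaging argument for groupoids.  A linear projection \<open>\<pi>\<close> onto the left ideal \<open>N\<close> is
  averaged over the arrows \<open>s\<close> starting at one chosen object of each connected component, with the
  inverse sizes of the H-classes as weights.  The average \<open>avg\<close> is linear over the algebra, hence
  right multiplication by its value \<open>e\<close> at \<open>\<one>\<close>, and it is the identity on \<open>N\<close>, as for each target the
  weights of the chosen arrows sum up to \<open>\<one>\<close>.
\<close>

lemma left_ideal_right_unit:
  assumes inv: "\<And>a. a \<in> carrier M \<Longrightarrow> [card (M.hclass a)] \<cdot>\<^bsub>K\<^esub> \<one>\<^bsub>K\<^esub> \<noteq> \<zero>\<^bsub>K\<^esub>"
    and N: "left_ideal N KM"
  shows "\<exists>e\<in>N. \<forall>f\<in>N. f \<otimes>\<^bsub>KM\<^esub> e = f"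
proof -
  obtain p where pN: "\<And>s. s \<in> carrier M \<Longrightarrow> p s \<in> N"
    and pid: "\<And>f. f \<in> N \<Longrightarrow> (\<Oplus>\<^bsub>KM\<^esub>s\<in>carrier M. f s \<odot>\<^bsub>KM\<^esub> p s) = f"
    using ex_projection_left_ideal[OF N] by blast
  have Nc: "f \<in> carrier KM" if "f \<in> N" for f using A.left_ideal_carrier[OF N that] .
  define \<pi> where "\<pi> f = (\<Oplus>\<^bsub>KM\<^esub>s\<in>carrier M. f s \<odot>\<^bsub>KM\<^esub> p s)" for f
  have summand: "(\<lambda>s. f s \<odot>\<^bsub>KM\<^esub> p s) \<in> carrier M \<rightarrow> carrier KM" if "f \<in> carrier KM" for f
    using that Nc[OF pN] by auto
  have \<pi>N: "\<pi> f \<in> N" if "f \<in> carrier KM" for f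
    unfolding \<pi>_def using that by (intro A.left_ideal_finsum[OF N] left_ideal_smult[OF N] pN) auto
  have \<pi>c [simp]: "\<pi> f \<in> carrier KM" if "f \<in> carrier KM" for f using Nc[OF \<pi>N[OF that]] .
  have \<pi>_zero [simp]: "\<pi> \<zero>\<^bsub>KM\<^esub> = \<zero>\<^bsub>KM\<^esub>"
    unfolding \<pi>_def using Nc[OF pN] by (intro A.add.finprod_one_eqI) (simp add: KM_simps(2))
  have \<pi>_add: "\<pi> (f \<oplus>\<^bsub>KM\<^esub> g) = \<pi> f \<oplus>\<^bsub>KM\<^esub> \<pi> g" if "f \<in> carrier KM" "g \<in> carrier KM" for f g
  proof -
    have "\<pi> (f \<oplus>\<^bsub>KM\<^esub> g) = (\<Oplus>\<^bsub>KM\<^esub>s\<in>carrier M. f s \<odot>\<^bsub>KM\<^esub> p s \<oplus>\<^bsub>KM\<^esub> g s \<odot>\<^bsub>KM\<^esub> p s)"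
      unfolding \<pi>_def using that Nc[OF pN]
      by (intro A.finsum_cong') (auto simp: add_KM_apply A.smult_l_distr)
    then show ?thesis
      unfolding \<pi>_def using A.finsum_addf[OF summand summand, OF that] by simp
  qed
  have \<pi>_smult: "\<pi> (c \<odot>\<^bsub>KM\<^esub> f) = c \<odot>\<^bsub>KM\<^esub> \<pi> f" if "c \<in> carrier K" "f \<in> carrier KM" for c f
  proof -
    have "\<pi> (c \<odot>\<^bsub>KM\<^esub> f) = (\<Oplus>\<^bsub>KM\<^esub>s\<in>carrier M. c \<odot>\<^bsub>KM\<^esub> (f s \<odot>\<^bsub>KM\<^esub> p s))"
      unfolding \<pi>_def using that Nc[OF pN]
      by (intro A.finsum_cong') (auto simp: smult_KM_apply A.smult_assoc1)
    then show ?thesis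
      unfolding \<pi>_def using A.finsum_smult_ldistr[OF finite_M that(1) summand[OF that(2)]] by simp
  qed
  let ?T = "M.transversal"
  have Tc: "s \<in> carrier M" if "s \<in> ?T" for s using that M.transversal_carrier by blast
  have finT [simp]: "finite ?T" using M.transversal_carrier finite_M by (rule finite_subset)
  define w where "w s = inv\<^bsub>K\<^esub> ([card (M.hclass s)] \<cdot>\<^bsub>K\<^esub> \<one>\<^bsub>K\<^esub>)" for s
  have unit: "[card (M.hclass s)] \<cdot>\<^bsub>K\<^esub> \<one>\<^bsub>K\<^esub> \<in> Units K" if "s \<in> carrier M" for s
    using inv[OF that] K.field_Units by simp
  have wc [simp]: "w s \<in> carrier K" if "s \<in> carrier M" for s
    using unit[OF that] unfolding w_def by simp
  define avg where "avg f = (\<Oplus>\<^bsub>KM\<^esub>s\<in>?T. w s \<odot>\<^bsub>KM\<^esub> (mob s \<otimes>\<^bsub>KM\<^esub> \<pi> (mob (s\<^sup>\<star>) \<otimes>\<^bsub>KM\<^esub> f)))" for f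
  have avg_summand: "(\<lambda>s. w s \<odot>\<^bsub>KM\<^esub> (mob s \<otimes>\<^bsub>KM\<^esub> \<pi> (mob (s\<^sup>\<star>) \<otimes>\<^bsub>KM\<^esub> f))) \<in> ?T \<rightarrow> carrier KM"
    if "f \<in> carrier KM" for f
    using that Tc by auto
  define e where "e = (\<Oplus>\<^bsub>KM\<^esub>s\<in>?T. w s \<odot>\<^bsub>KM\<^esub> (mob s \<otimes>\<^bsub>KM\<^esub> \<pi> (mob (s\<^sup>\<star>))))"
  have e_summand: "(\<lambda>s. w s \<odot>\<^bsub>KM\<^esub> (mob s \<otimes>\<^bsub>KM\<^esub> \<pi> (mob (s\<^sup>\<star>)))) \<in> ?T \<rightarrow> carrier KM"
    using Tc by auto
  have eN: "e \<in> N"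
    unfolding e_def using Tc
    by (intro A.left_ideal_finsum[OF N] left_ideal_smult[OF N] A.left_ideal_mult[OF N] \<pi>N) auto
  have ec: "e \<in> carrier KM" using Nc[OF eN] .
  have mob_e: "mob t \<otimes>\<^bsub>KM\<^esub> e = avg (mob t)" if t: "t \<in> carrier M" for t
  proof -
    let ?k = "\<lambda>s. w s \<odot>\<^bsub>KM\<^esub> (mob s \<otimes>\<^bsub>KM\<^esub> \<pi> (mob (s\<^sup>\<star>) \<otimes>\<^bsub>KM\<^esub> mob t))"
    let ?S = "{s \<in> ?T. M.tgt s = M.src t}"
    have "mob t \<otimes>\<^bsub>KM\<^esub> e = (\<Oplus>\<^bsub>KM\<^esub>s\<in>?T. mob t \<otimes>\<^bsub>KM\<^esub> (w s \<odot>\<^bsub>KM\<^esub> (mob s \<otimes>\<^bsub>KM\<^esub> \<pi> (mob (s\<^sup>\<star>)))))"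
      unfolding e_def using t e_summand by (intro A.finsum_rdistr) auto
    \<comment> \<open>The term at \<open>s\<close> is the term of \<open>avg (mob t)\<close> at \<open>t \<otimes> s\<close>, since \<open>(t \<otimes> s)\<^sup>\<star> \<otimes> t = s\<^sup>\<star>\<close>.\<close>
    also have "\<dots> = (\<Oplus>\<^bsub>KM\<^esub>s\<in>?S. ?k (t \<otimes>\<^bsub>M\<^esub> s))"
    proof (rule A.add.finprod_mono_neutral_cong_right)
      show "mob t \<otimes>\<^bsub>KM\<^esub> (w s \<odot>\<^bsub>KM\<^esub> (mob s \<otimes>\<^bsub>KM\<^esub> \<pi> (mob (s\<^sup>\<star>)))) = \<zero>\<^bsub>KM\<^esub>" if "s \<in> ?T - ?S" for s
        using that t Tc[of s]
        by (auto simp: A.smult_mult_right A.m_assoc[symmetric] mob_mult)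
      show "mob t \<otimes>\<^bsub>KM\<^esub> (w s \<odot>\<^bsub>KM\<^esub> (mob s \<otimes>\<^bsub>KM\<^esub> \<pi> (mob (s\<^sup>\<star>)))) = ?k (t \<otimes>\<^bsub>M\<^esub> s)" if s: "s \<in> ?S" for s
      proof -
        have sc: "s \<in> carrier M" and st: "M.src t = M.tgt s" using s Tc by auto
        have "w (t \<otimes>\<^bsub>M\<^esub> s) = w s"
          unfolding w_def using M.card_hclass_mult_left[OF sc t st] by simp
        moreover have "(t \<otimes>\<^bsub>M\<^esub> s)\<^sup>\<star> \<otimes>\<^bsub>M\<^esub> t = s\<^sup>\<star>"
          using t sc st M.sinv_mult_tgt[OF sc] by (simp add: M.sinv_mult M.m_assoc M.src_def)
        moreover have "M.src ((t \<otimes>\<^bsub>M\<^esub> s)\<^sup>\<star>) = M.tgt t"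
          using M.composable[OF t sc st] t sc by simp
        ultimately show ?thesis
          using t sc st by (simp add: A.smult_mult_right A.m_assoc[symmetric] mob_mult)
      qed
    qed (use t Tc in auto)
    also have "\<dots> = (\<Oplus>\<^bsub>KM\<^esub>s\<in>(\<lambda>s. t \<otimes>\<^bsub>M\<^esub> s) ` ?S. ?k s)"
    proof (rule A.finsum_reindex[symmetric])
      show "inj_on (\<lambda>s. t \<otimes>\<^bsub>M\<^esub> s) ?S"
        using t Tc by (intro inj_on_inverseI[of _ "\<lambda>s. t\<^sup>\<star> \<otimes>\<^bsub>M\<^esub> s"]) (auto intro!: M.cancel_composable)
    qed (use t Tc in auto)
    also have "(\<lambda>s. t \<otimes>\<^bsub>M\<^esub> s) ` ?S = {s \<in> ?T. M.tgt s = M.tgt t}"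
    proof (intro equalityI subsetI)
      fix s assume "s \<in> (\<lambda>s. t \<otimes>\<^bsub>M\<^esub> s) ` ?S"
      then show "s \<in> {s \<in> ?T. M.tgt s = M.tgt t}"
        using t Tc M.transversal_mult[OF _ t] M.composable[OF t] by auto
    next
      fix s assume s: "s \<in> {s \<in> ?T. M.tgt s = M.tgt t}"
      then have sc: "s \<in> carrier M" using Tc by blast
      have "t\<^sup>\<star> \<otimes>\<^bsub>M\<^esub> s \<in> ?S"
        using s sc t M.transversal_mult[of s "t\<^sup>\<star>"] M.composable[of "t\<^sup>\<star>" s] by auto
      moreover have "s = t \<otimes>\<^bsub>M\<^esub> (t\<^sup>\<star> \<otimes>\<^bsub>M\<^esub> s)"
        using s sc t M.cancel_composable(2)[of t s] by auto
      ultimately show "s \<in> (\<lambda>s. t \<otimes>\<^bsub>M\<^esub> s) ` ?S" by blast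
    qed
    also have "(\<Oplus>\<^bsub>KM\<^esub>s\<in>{s \<in> ?T. M.tgt s = M.tgt t}. ?k s) = avg (mob t)"
      unfolding avg_def using t Tc avg_summand[OF mob_closed[OF t]]
      by (intro A.add.finprod_mono_neutral_cong_left) (auto simp: mob_mult)
    finally show ?thesis .
  qed
  have f_e: "f \<otimes>\<^bsub>KM\<^esub> e = avg f" if "f \<in> carrier KM" for f
    using that
  proof (induction f rule: mob_induct)
    case zero
    have "avg \<zero>\<^bsub>KM\<^esub> = \<zero>\<^bsub>KM\<^esub>"
      unfolding avg_def using Tc by (intro A.add.finprod_one_eqI) simp
    then show ?case using ec by simp
  next
    case (mob c t)
    have "avg (c \<odot>\<^bsub>KM\<^esub> mob t)
      = (\<Oplus>\<^bsub>KM\<^esub>s\<in>?T. c \<odot>\<^bsub>KM\<^esub> (w s \<odot>\<^bsub>KM\<^esub> (mob s \<otimes>\<^bsub>KM\<^esub> \<pi> (mob (s\<^sup>\<star>) \<otimes>\<^bsub>KM\<^esub> mob t))))"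
      unfolding avg_def
    proof (rule A.finsum_cong'[OF refl])
      fix s assume "s \<in> ?T"
      then have s: "s \<in> carrier M" by (rule Tc)
      then show "w s \<odot>\<^bsub>KM\<^esub> (mob s \<otimes>\<^bsub>KM\<^esub> \<pi> (mob (s\<^sup>\<star>) \<otimes>\<^bsub>KM\<^esub> (c \<odot>\<^bsub>KM\<^esub> mob t)))
        = c \<odot>\<^bsub>KM\<^esub> (w s \<odot>\<^bsub>KM\<^esub> (mob s \<otimes>\<^bsub>KM\<^esub> \<pi> (mob (s\<^sup>\<star>) \<otimes>\<^bsub>KM\<^esub> mob t)))"
        using mob by (simp add: A.smult_mult_right \<pi>_smult A.smult_assoc1[symmetric] K.m_comm)
    qed (use mob Tc in auto)
    also have "\<dots> = c \<odot>\<^bsub>KM\<^esub> avg (mob t)"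
      unfolding avg_def using mob avg_summand by (intro A.finsum_smult_ldistr[symmetric]) auto
    finally show ?case using mob ec mob_e by (simp add: A.smult_mult_left)
  next
    case (add f g)
    have "avg (f \<oplus>\<^bsub>KM\<^esub> g)
      = (\<Oplus>\<^bsub>KM\<^esub>s\<in>?T. w s \<odot>\<^bsub>KM\<^esub> (mob s \<otimes>\<^bsub>KM\<^esub> \<pi> (mob (s\<^sup>\<star>) \<otimes>\<^bsub>KM\<^esub> f))
        \<oplus>\<^bsub>KM\<^esub> w s \<odot>\<^bsub>KM\<^esub> (mob s \<otimes>\<^bsub>KM\<^esub> \<pi> (mob (s\<^sup>\<star>) \<otimes>\<^bsub>KM\<^esub> g)))"
      unfolding avg_def using add Tc
      by (intro A.finsum_cong') (auto simp: A.r_distr \<pi>_add A.smult_r_distr)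
    also have "\<dots> = avg f \<oplus>\<^bsub>KM\<^esub> avg g"
      unfolding avg_def using add avg_summand by (intro A.finsum_addf) auto
    finally show ?case using add ec by (simp add: A.l_distr)
  qed
  have "avg f = f" if f: "f \<in> N" for f
  proof -
    let ?E = "{e \<in> carrier M. M.tgt e = e}"
    let ?k = "\<lambda>s. w s \<odot>\<^bsub>KM\<^esub> (mob (M.tgt s) \<otimes>\<^bsub>KM\<^esub> f)"
    let ?F = "\<lambda>e. {s \<in> ?T. M.tgt s = e}"
    have fc: "f \<in> carrier KM" using Nc[OF f] .
    have "avg f = (\<Oplus>\<^bsub>KM\<^esub>s\<in>?T. ?k s)"
      unfolding avg_def
    proof (rule A.finsum_cong'[OF refl])
      fix s assume "s \<in> ?T"
      then have s: "s \<in> carrier M" by (rule Tc)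
      have "mob (s\<^sup>\<star>) \<otimes>\<^bsub>KM\<^esub> f \<in> N"
        using s A.left_ideal_mult[OF N _ f] by simp
      then have "\<pi> (mob (s\<^sup>\<star>) \<otimes>\<^bsub>KM\<^esub> f) = mob (s\<^sup>\<star>) \<otimes>\<^bsub>KM\<^esub> f"
        unfolding \<pi>_def by (rule pid)
      then show "w s \<odot>\<^bsub>KM\<^esub> (mob s \<otimes>\<^bsub>KM\<^esub> \<pi> (mob (s\<^sup>\<star>) \<otimes>\<^bsub>KM\<^esub> f)) = ?k s"
        using s fc by (simp add: A.m_assoc[symmetric] mob_mult M.tgt_def[symmetric])
    qed (use fc Tc in auto)
    also have "?T = (\<Union>e\<in>?E. ?F e)" using Tc by auto
    also have "(\<Oplus>\<^bsub>KM\<^esub>s\<in>(\<Union>e\<in>?E. ?F e). ?k s) = (\<Oplus>\<^bsub>KM\<^esub>e\<in>?E. \<Oplus>\<^bsub>KM\<^esub>s\<in>?F e. ?k s)"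
      using fc Tc by (intro A.add.finprod_UN_disjoint) (auto simp: pairwise_def disjnt_def)
    also have "\<dots> = (\<Oplus>\<^bsub>KM\<^esub>e\<in>?E. mob e \<otimes>\<^bsub>KM\<^esub> f)"
    proof (rule A.finsum_cong'[OF refl])
      fix e assume e: "e \<in> ?E"
      obtain u where u: "u \<in> carrier M" "M.tgt u = e" "?F e = M.hclass u"
        using M.transversal_fibre[of e] e by blast
      have v: "mob e \<otimes>\<^bsub>KM\<^esub> f \<in> carrier KM" using e fc by simp
      have "(\<Oplus>\<^bsub>KM\<^esub>s\<in>?F e. ?k s) = (\<Oplus>\<^bsub>KM\<^esub>s\<in>M.hclass u. w u \<odot>\<^bsub>KM\<^esub> (mob e \<otimes>\<^bsub>KM\<^esub> f))"
        unfolding u(3)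
      proof (rule A.finsum_cong'[OF refl])
        fix s assume "s \<in> M.hclass u"
        then have s: "s \<in> carrier M" "M.tgt s = e" "M.hclass s = M.hclass u"
          using u unfolding M.hclass_def by auto
        then show "?k s = w u \<odot>\<^bsub>KM\<^esub> (mob e \<otimes>\<^bsub>KM\<^esub> f)" unfolding w_def by simp
      qed (use u v in auto)
      also have "\<dots> = ([card (M.hclass u)] \<cdot>\<^bsub>K\<^esub> \<one>\<^bsub>K\<^esub> \<otimes>\<^bsub>K\<^esub> w u) \<odot>\<^bsub>KM\<^esub> (mob e \<otimes>\<^bsub>KM\<^esub> f)"
        using u v by (simp add: finsum_KM_const A.smult_assoc1)
      also have "[card (M.hclass u)] \<cdot>\<^bsub>K\<^esub> \<one>\<^bsub>K\<^esub> \<otimes>\<^bsub>K\<^esub> w u = \<one>\<^bsub>K\<^esub>"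
        unfolding w_def using unit[OF u(1)] by simp
      finally show "(\<Oplus>\<^bsub>KM\<^esub>s\<in>?F e. ?k s) = mob e \<otimes>\<^bsub>KM\<^esub> f" using v by simp
    qed (use fc in auto)
    also have "\<dots> = \<one>\<^bsub>KM\<^esub> \<otimes>\<^bsub>KM\<^esub> f"
      unfolding one_eq_sum_mob using fc by (intro A.finsum_ldistr[symmetric]) auto
    finally show ?thesis using fc by simp
  qed
  then have "f \<otimes>\<^bsub>KM\<^esub> e = f" if "f \<in> N" for f using that f_e Nc by simp
  then show ?thesis using eN by blast
qed

theorem semisimple_iff_card_hclass:
  "semisimple_ring KM \<longleftrightarrow> (\<forall>a\<in>carrier M. [card (M.hclass a)] \<cdot>\<^bsub>K\<^esub> \<one>\<^bsub>K\<^esub> \<noteq> \<zero>\<^bsub>K\<^esub>)"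
  using semisimple_imp_card_hclass left_ideal_right_unit
    A.semisimple_ring_if_left_ideals_idempotent_generated by blast

end

text \<open>A group is an inverse monoid with a single H-class, so Maschke's theorem is a special case.\<close>

theorem maschke:
  assumes "field K" "group G" "finite (carrier G)"
  shows "semisimple_ring (monoid_algebra K G) \<longleftrightarrow> [card (carrier G)] \<cdot>\<^bsub>K\<^esub> \<one>\<^bsub>K\<^esub> \<noteq> \<zero>\<^bsub>K\<^esub>"
proof -
  interpret G: group G by fact
  interpret finite_inverse_monoid_algebra K G
    using assms G.inverse_monoid_group G.monoid_axioms
    by (simp add: finite_inverse_monoid_algebra_def finite_monoid_algebra_def
        finite_monoid_algebra_axioms_def)
  show ?thesis
    unfolding semisimple_iff_card_hclass using G.hclass_group G.one_closed by auto
qed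

theorem corollary4p7:
  fixes K :: "('k, 'r) ring_scheme" and M :: "('m, 's) monoid_scheme"
  assumes "field K"
    and "monoid M" and "finite (carrier M)"
    and "inverse_semigroup M"
    and "CA_condition K M"
  shows "semisimple_ring (monoid_algebra K M) \<longleftrightarrow>
    (\<forall>D\<in>D_classes M. semisimple_ring (monoid_algebra K (schutzenberger_group M D)))"
proof -
  interpret finite_inverse_monoid_algebra K M
    using assms
    by (simp add: finite_inverse_monoid_algebra_def finite_monoid_algebra_def
        finite_monoid_algebra_axioms_def inverse_monoid_def inverse_monoid_axioms_def)
  have schutz: "semisimple_ring (monoid_algebra K (schutzenberger_group M (green_D M `` {a})))
      \<longleftrightarrow> [card (M.hclass a)] \<cdot>\<^bsub>K\<^esub> \<one>\<^bsub>K\<^esub> \<noteq> \<zero>\<^bsub>K\<^esub>" if a: "a \<in> carrier M" for a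
  proof -
    obtain b where b: "b \<in> carrier M" "card (M.hclass b) = card (M.hclass a)"
      "schutzenberger_group M (green_D M `` {a}) = schutzenberger_of M (M.hclass b)"
      using M.schutzenberger_group_hclass[OF a] by blast
    have "finite (M.hclass b)" using M.hclass_carrier finite_M by (rule finite_subset)
    then have "card (M.hclass b) > 0"
      using M.hclass_self[OF b(1)] card_gt_0_iff by blast
    then have "card (carrier (schutzenberger_of M (M.hclass b))) > 0"
      using M.card_schutzenberger_of[OF b(1)] by simp
    then have "finite (carrier (schutzenberger_of M (M.hclass b)))" by (rule card_ge_0_finite)
    from maschke[OF assms(1) M.group_schutzenberger_of[OF b(1)] this] show ?thesis
      unfolding b(3) M.card_schutzenberger_of[OF b(1)] b(2) .
  qed
  show ?thesis
    unfolding semisimple_iff_card_hclass D_classes_def quotient_def using schutz by auto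
qed

end
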